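(* One has $$\lim_{n\to\infty}\frac{A_n}{N_n}=1.$$ In particular, the sequences $(A_{2n})$ and $(A_{2n+1})$ grow asymptotically as constant multiples of $2^n$, i.e. there are positive real numbers $c_0,c_1$ such that $\lim_{n\to\infty} A_{2n}/2^n=c_0$ and $\lim_{n\to\infty}A_{2n+1}/2^n=c_1$.
   Context: $\mathbb{N}$ is the set of nonnegative integers. A numerical semigroup is a subset $S\subseteq\mathbb{N}$ that contains $0$, is closed under addition, and has finite complement in $\mathbb{N}$. Every numerical semigroup $S$ has a unique minimal generating set, which is finite; it is denoted $P(S)$ and its elements are called primitives. For $S\neq\mathbb{N}$ the Frobenius number $F(S)$ is the largest element of $\mathbb{N}\setminus S$; by convention $F(\mathbb{N})=-1$. For a positive integer $n$, $A_n$ denotes the number of numerical semigroups $S$ with $\max P(S)=n$, and $N_n$ denotes the number of numerical semigroups $S$ with $F(S)=n$. *)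

theory Defs
  imports Complex_Main
begin

definition submonoid :: "nat set \<Rightarrow> bool" where
  "submonoid M \<longleftrightarrow> 0 \<in> M \<and> (\<forall>a\<in>M. \<forall>b\<in>M. a + b \<in> M)"

definition numerical_semigroup :: "nat set \<Rightarrow> bool" where
  "numerical_semigroup S \<longleftrightarrow> submonoid S \<and> finite (- S)"

definition generates :: "nat set \<Rightarrow> nat set \<Rightarrow> bool" where
  "generates G S \<longleftrightarrow> submonoid hull G = S"

definition minimal_generating_set :: "nat set \<Rightarrow> nat set \<Rightarrow> bool" where
  "minimal_generating_set G S \<longleftrightarrow> generates G S \<and> (\<forall>H. H \<subset> G \<longrightarrow> \<not> generates H S)"

text \<open>The description is proper for numerical semigroups: see
  \<open>ex1_minimal_generating_set\<close> and \<open>finite_primitives\<close> below.\<close>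
definition primitives :: "nat set \<Rightarrow> nat set" where
  "primitives S = (THE G. minimal_generating_set G S)"

definition frobenius :: "nat set \<Rightarrow> int" where
  "frobenius S = (if S = UNIV then - 1 else int (Max (- S)))"

definition num_by_max_primitive :: "nat \<Rightarrow> nat" where
  "num_by_max_primitive n = card {S. numerical_semigroup S \<and> Max (primitives S) = n}"

definition num_by_frobenius :: "nat \<Rightarrow> nat" where
  "num_by_frobenius n = card {S. numerical_semigroup S \<and> frobenius S = int n}"


lemma submonoid_hull: "submonoid (submonoid hull G)"
  by (rule hull_in) (auto simp: submonoid_def)

definition indecomposables :: "nat set \<Rightarrow> nat set" where
  "indecomposables S = {x \<in> S. x \<noteq> 0 \<and> (\<forall>a\<in>S. \<forall>b\<in>S. a \<noteq> 0 \<longrightarrow> b \<noteq> 0 \<longrightarrow> x \<noteq> a + b)}"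

lemma indecomposables_subset:
  assumes "generates G S"
  shows "indecomposables S \<subseteq> G"
proof
  fix x assume x: "x \<in> indecomposables S"
  have S: "submonoid S" and GS: "G \<subseteq> S"
    using assms submonoid_hull hull_subset by (metis generates_def)+
  show "x \<in> G"
  proof (rule ccontr)
    assume "x \<notin> G"
    have "submonoid (S - {x})"
      unfolding submonoid_def
    proof (intro conjI ballI)
      show "0 \<in> S - {x}" using S x by (auto simp: submonoid_def indecomposables_def)
      fix a b assume ab: "a \<in> S - {x}" "b \<in> S - {x}"
      then have "a + b \<in> S" using S by (auto simp: submonoid_def)
      moreover have "a + b \<noteq> x"
        using ab x by (cases "a = 0"; cases "b = 0") (auto simp: indecomposables_def)
      ultimately show "a + b \<in> S - {x}" by auto
    qed
    then have "submonoid hull G \<subseteq> S - {x}"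
      using GS \<open>x \<notin> G\<close> by (intro hull_minimal) auto
    then show False using assms x by (auto simp: generates_def indecomposables_def)
  qed
qed

lemma indecomposables_generate:
  assumes "submonoid S"
  shows "generates (indecomposables S) S"
proof -
  let ?H = "submonoid hull (indecomposables S)"
  have H: "submonoid ?H" by (rule submonoid_hull)
  have "x \<in> S \<longrightarrow> x \<in> ?H" for x
  proof (induction x rule: less_induct)
    case (less x)
    show ?case
    proof
      assume xS: "x \<in> S"
      consider "x = 0" | "x \<in> indecomposables S"
        | a b where "a \<in> S" "b \<in> S" "a \<noteq> 0" "b \<noteq> 0" "x = a + b"
        using xS by (auto simp: indecomposables_def)
      then show "x \<in> ?H"
      proof cases
        case 1 then show ?thesis using H by (simp add: submonoid_def)
      next
        case 2 then show ?thesis by (rule hull_inc)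
      next
        case 3
        then have "a \<in> ?H" "b \<in> ?H" using less.IH by auto
        then show ?thesis using H 3 by (auto simp: submonoid_def)
      qed
    qed
  qed
  moreover have "?H \<subseteq> S"
    using assms by (intro hull_minimal) (auto simp: indecomposables_def)
  ultimately show ?thesis by (auto simp: generates_def)
qed

lemma minimal_generating_set_iff:
  assumes "submonoid S"
  shows "minimal_generating_set G S \<longleftrightarrow> G = indecomposables S"
  using indecomposables_generate[OF assms] indecomposables_subset
  unfolding minimal_generating_set_def by blast

lemma ex1_minimal_generating_set:
  assumes "numerical_semigroup S"
  shows "\<exists>!G. minimal_generating_set G S"
  using assms by (simp add: numerical_semigroup_def minimal_generating_set_iff)

lemma minimal_generating_set_primitives:
  assumes "numerical_semigroup S"
  shows "minimal_generating_set (primitives S) S"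
  unfolding primitives_def by (rule theI'[OF ex1_minimal_generating_set[OF assms]])

lemma primitives_eq_indecomposables:
  assumes "numerical_semigroup S"
  shows "primitives S = indecomposables S"
  using minimal_generating_set_primitives[OF assms] assms
  by (simp add: numerical_semigroup_def minimal_generating_set_iff)

lemma finite_primitives:
  assumes "numerical_semigroup S"
  shows "finite (primitives S)"
proof -
  have fin: "finite (- S)" using assms by (simp add: numerical_semigroup_def)
  have "\<not> finite S"
    using fin finite_compl infinite_UNIV_nat by blast
  then obtain m where m: "m \<in> S" "m > 0"
    by (metis finite.simps finite_subset gr0I insertI1 singletonI subsetI)
  have "indecomposables S \<subseteq> {..m} \<union> (\<lambda>y. y + m) ` (- S)"
  proof
    fix x assume x: "x \<in> indecomposables S"
    show "x \<in> {..m} \<union> (\<lambda>y. y + m) ` (- S)"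
    proof (cases "x \<le> m")
      case False
      then have "x = (x - m) + m" "x - m \<noteq> 0" by auto
      then have "x - m \<notin> S" using x m unfolding indecomposables_def by blast
      with \<open>x = (x - m) + m\<close> show ?thesis by blast
    qed simp
  qed
  then show ?thesis
    using fin by (simp add: primitives_eq_indecomposables[OF assms] finite_subset)
qed

lemma primitives_nonempty:
  assumes "numerical_semigroup S"
  shows "primitives S \<noteq> {}"
proof
  assume "primitives S = {}"
  then have "S = submonoid hull {}"
    using minimal_generating_set_primitives[OF assms]
    by (simp add: minimal_generating_set_def generates_def)
  also have "\<dots> \<subseteq> {0}" by (rule hull_minimal) (auto simp: submonoid_def)
  finally have "finite S" by (rule finite_subset) simp
  with assms show False
    by (simp add: numerical_semigroup_def)
qed

text \<open>The cardinalities above count finite sets.\<close>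

lemma finite_by_max_primitive:
  "finite {S. numerical_semigroup S \<and> Max (primitives S) = n}" (is "finite ?A")
proof -
  have "?A \<subseteq> (\<lambda>G. submonoid hull G) ` Pow {..n}"
  proof
    fix S assume "S \<in> ?A"
    then have S: "numerical_semigroup S" "Max (primitives S) = n" by auto
    have "primitives S \<subseteq> {..n}" using finite_primitives[OF S(1)] S(2) by auto
    moreover have "S = submonoid hull (primitives S)"
      using minimal_generating_set_primitives[OF S(1)]
      by (simp add: minimal_generating_set_def generates_def)
    ultimately show "S \<in> (\<lambda>G. submonoid hull G) ` Pow {..n}" by blast
  qed
  then show ?thesis by (rule finite_subset) simp
qed

lemma finite_by_frobenius:
  "finite {S. numerical_semigroup S \<and> frobenius S = int n}" (is "finite ?A")
proof -
  have "?A \<subseteq> uminus ` Pow {..n}"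
  proof
    fix S assume "S \<in> ?A"
    then have S: "finite (- S)" "Max (- S) = n"
      by (auto simp: numerical_semigroup_def frobenius_def split: if_splits)
    then have "- S \<subseteq> {..n}" by (metis Max_ge atMost_iff subsetI)
    then show "S \<in> uminus ` Pow {..n}" by (metis Pow_iff boolean_algebra_class.boolean_algebra.double_compl image_eqI)
  qed
  then show ?thesis by (rule finite_subset) simp
qed

end

theory Submission
  imports Defs "HOL-Analysis.Analysis" "HOL-Real_Asymp.Real_Asymp"
begin

text \<open>
  Below \<open>n\<close>, a semigroup with Frobenius number \<open>n\<close> and a semigroup with largest primitive \<open>n\<close> look
  alike: both are a set \<open>X \<subseteq> {1..<n}\<close> containing every sum \<open>x + y \<le> n\<close> of its elements (so \<open>n\<close>
  is not such a sum). Every \<open>X\<close> comes from exactly one semigroup of the first kind, and from one of the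
  second kind iff \<open>X \<union> {n}\<close> has greatest common divisor \<open>1\<close>. An exceptional \<open>X\<close> consists of multiples
  of some \<open>d > 1\<close> dividing \<open>n\<close>, and dividing by \<open>d\<close> gives a set of the same kind for \<open>n / d\<close>.
  Hence \<open>A\<^sub>n \<sim> N\<^sub>n\<close> once \<open>N\<^sub>n\<close> is known to have order \<open>2 ^ (n / 2)\<close>.

  To see that \<open>N\<^sub>n / 2 ^ (n / 2)\<close> converges for each parity of \<open>n\<close> (a theorem of Backelin), sort the \<open>X\<close>
  by their minimum \<open>m = (n - R) / 2\<close>. For fixed \<open>R\<close> and \<open>m > R\<close> the elements in \<open>(m + R, 2 m)\<close> are
  unconstrained, so the count is exactly a constant times \<open>2 ^ m\<close>. By Tannery's theorem it remains to bound
  the count by \<open>f R * 2 ^ (n / 2)\<close> with \<open>f\<close> summable. In Kunz coordinates modulo \<open>m\<close>, two residues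
  adding up to \<open>n\<close> have together at most as many options as the critical rate \<open>2 ^ (n / 2)\<close> allows;
  an exponential gain in \<open>R\<close> comes from the residues \<open>r\<close> with \<open>r + 3 m \<le> n\<close> if there are many of them,
  and otherwise from a second element \<open>m + a\<close> slightly below \<open>n / 2\<close>, or from the absence of one.
\<close>

section \<open>Truncated semigroups\<close>

definition truncations :: "nat \<Rightarrow> nat set set" where
  "truncations n = {X. X \<subseteq> {1..<n} \<and> (\<forall>x\<in>X. \<forall>y\<in>X. x + y \<le> n \<longrightarrow> x + y \<in> X)}"

definition truncations_min :: "nat \<Rightarrow> nat \<Rightarrow> nat set set" where
  "truncations_min n m = {X \<in> truncations n. m \<in> X \<and> X \<subseteq> {m..}}"

lemma finite_truncations [simp]: "finite (truncations n)"
  by (rule finite_subset[of _ "Pow {1..<n}"]) (auto simp: truncations_def)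

lemma finite_truncations_min [simp]: "finite (truncations_min n m)"
  by (simp add: truncations_min_def)

lemma truncations_add:
  "X \<in> truncations n \<Longrightarrow> x \<in> X \<Longrightarrow> y \<in> X \<Longrightarrow> x + y \<le> n \<Longrightarrow> x + y \<in> X"
  by (auto simp: truncations_def)

lemma truncations_less: "X \<in> truncations n \<Longrightarrow> x \<in> X \<Longrightarrow> x < n"
  by (auto simp: truncations_def)

lemma truncations_not_sum: "X \<in> truncations n \<Longrightarrow> x \<in> X \<Longrightarrow> y \<in> X \<Longrightarrow> x + y \<noteq> n"
  using truncations_add[of X n x y] truncations_less[of X n "x + y"] by auto

section \<open>Kunz coordinates\<close>

locale window =
  fixes n m :: nat
  assumes m_pos: "0 < m" and two_m: "2 * m < n"
begin

definition ht :: "nat \<Rightarrow> nat" where "ht r = (n - r) div m"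

definition mirror :: "nat \<Rightarrow> nat" where "mirror r = (n - r) mod m"

text \<open>The value \<open>ht r + 1\<close> means that no element of \<open>X\<close> is congruent to \<open>r\<close>.\<close>

definition kunz :: "nat set \<Rightarrow> nat \<Rightarrow> nat" where
  "kunz X r = (LEAST k. ht r < k \<or> r + m * k \<in> X)"

lemma mirror_less: "mirror r < m"
  using m_pos by (simp add: mirror_def)

lemma mirror_eq: "r < m \<Longrightarrow> r + mirror r + m * ht r = n"
  using two_m mod_mult_div_eq[of "n - r" m] unfolding mirror_def ht_def by linarith

lemma ht_mirrorI:
  assumes "r + s + m * q = n" "s < m"
  shows "mirror r = s" "ht r = q"
proof -
  have "n - r = s + m * q" using assms by linarith
  then show "mirror r = s" "ht r = q" using assms(2) m_pos by (simp_all add: mirror_def ht_def)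
qed

text \<open>The equation \<open>r + mirror r + m * ht r = n\<close> is symmetric in the two
  residues, and division with remainder is unique.\<close>

lemma mirror_mirror: "r < m \<Longrightarrow> mirror (mirror r) = r"
  and ht_mirror: "r < m \<Longrightarrow> ht (mirror r) = ht r"
  using ht_mirrorI[of "mirror r" r "ht r"] mirror_eq[of r] by (simp_all add: add.commute)

lemma le_n_iff: "r < m \<Longrightarrow> r + m * k \<le> n \<longleftrightarrow> k \<le> ht r"
  using two_m m_pos less_eq_div_iff_mult_less_eq[of m k "n - r"]
  unfolding ht_def mult.commute[of m k] by linarith

lemma ht_pos: "r < m \<Longrightarrow> 0 < ht r"
  using le_n_iff[of r 1] two_m by simp

context
  fixes X assumes X: "X \<in> truncations_min n m"
begin

lemma X_trunc: "X \<in> truncations n" and m_in_X: "m \<in> X"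
  using X by (auto simp: truncations_min_def)

lemma X_up: "x \<in> X \<Longrightarrow> x + m * i \<le> n \<Longrightarrow> x + m * i \<in> X"
proof (induction i)
  case (Suc i)
  then show ?case
    using truncations_add[OF X_trunc _ m_in_X, of "x + m * i"] by (simp add: algebra_simps)
qed simp

lemma kunz_le: "kunz X r \<le> ht r + 1"
  unfolding kunz_def by (rule Least_le) simp

lemma kunz_mem: "kunz X r \<le> ht r \<Longrightarrow> r + m * kunz X r \<in> X"
  using LeastI[of "\<lambda>k. ht r < k \<or> r + m * k \<in> X" "ht r + 1"] unfolding kunz_def by auto

lemma mem_iff_kunz:
  assumes "r < m" "k \<le> ht r"
  shows "r + m * k \<in> X \<longleftrightarrow> kunz X r \<le> k"
proof
  assume "r + m * k \<in> X" then show "kunz X r \<le> k"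
    unfolding kunz_def by (intro Least_le) simp
next
  assume k: "kunz X r \<le> k"
  then have "r + m * kunz X r + m * (k - kunz X r) = r + m * k"
    by (simp flip: add_mult_distrib2)
  moreover have "r + m * kunz X r \<in> X" using k assms by (intro kunz_mem) simp
  ultimately show "r + m * k \<in> X"
    using X_up[of "r + m * kunz X r" "k - kunz X r"] assms le_n_iff[of r k] by metis
qed

lemma kunz_pos: "r < m \<Longrightarrow> 0 < kunz X r"
proof (rule ccontr)
  assume r: "r < m" "\<not> 0 < kunz X r"
  then have "r \<in> X" using mem_iff_kunz[of r 0] by simp
  then show False using X r by (auto simp: truncations_min_def)
qed

text \<open>Otherwise \<open>X\<close> would contain \<open>r + m * k\<close> and
  \<open>mirror r + m * (ht r - k)\<close> with \<open>k = kunz X r\<close>, whose sum is exactly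
  \<open>n\<close>.\<close>

lemma kunz_mirror:
  assumes r: "r < m"
  shows "ht r < kunz X r + kunz X (mirror r)"
proof (rule ccontr)
  assume "\<not> ?thesis"
  then have le: "kunz X r \<le> ht r" "kunz X (mirror r) \<le> ht r - kunz X r" by auto
  then have "r + m * kunz X r \<in> X" by (intro kunz_mem)
  moreover have "mirror r + m * (ht r - kunz X r) \<in> X"
    using le r by (subst mem_iff_kunz) (auto simp: mirror_less ht_mirror)
  moreover have "m * kunz X r + m * (ht r - kunz X r) = m * ht r"
    using le(1) by (simp flip: add_mult_distrib2)
  then have "r + m * kunz X r + (mirror r + m * (ht r - kunz X r)) = n"
    using mirror_eq[OF r] by linarith
  ultimately show False using truncations_not_sum[OF X_trunc] by blast
qed

text \<open>Besides adding multiples of \<open>m\<close> and avoiding the sum \<open>n\<close>, this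
  is the only instance of additive closure that enters the upper bound for a given minimum.\<close>

lemma kunz_add:
  assumes "r + a < m" "ht (r + a) = 2" "kunz X r = 1" "kunz X a = 1"
  shows "kunz X (r + a) \<le> 2"
proof -
  have "r + m \<in> X" "a + m \<in> X"
    using assms mem_iff_kunz[of r 1] mem_iff_kunz[of a 1] ht_pos[of r] ht_pos[of a] by auto
  moreover have "(r + m) + (a + m) \<le> n" using le_n_iff[of "r + a" 2] assms by simp
  ultimately have "(r + m) + (a + m) \<in> X" using truncations_add X_trunc by blast
  moreover have "(r + m) + (a + m) = r + a + m * 2" by simp
  ultimately show ?thesis using mem_iff_kunz[of "r + a" 2] assms by simp
qed

end

text \<open>Every \<open>x \<le> n\<close> is \<open>r + m * k\<close> with \<open>r < m\<close> and
  \<open>k \<le> ht r\<close>, and the coordinate of \<open>r\<close> decides whether it lies in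
  \<open>X\<close>.\<close>

lemma inj_on_kunz: "inj_on (\<lambda>X. restrict (kunz X) {..<m}) (truncations_min n m)"
proof (rule inj_onI)
  fix X Y assume XY: "X \<in> truncations_min n m" "Y \<in> truncations_min n m"
    and "restrict (kunz X) {..<m} = restrict (kunz Y) {..<m}"
  then have eq: "kunz X r = kunz Y r" if "r < m" for r
    using that by (metis lessThan_iff restrict_apply')
  have "x \<in> X \<longleftrightarrow> x \<in> Y" if "x \<le> n" for x
  proof -
    have "x mod m < m" "x mod m + m * (x div m) = x" using m_pos by auto
    moreover from this have "x div m \<le> ht (x mod m)" using le_n_iff that by metis
    ultimately show ?thesis using XY eq mem_iff_kunz by metis
  qed
  moreover have "X \<subseteq> {..n}" "Y \<subseteq> {..n}" using XY by (auto simp: truncations_min_def truncations_def)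
  ultimately show "X = Y" by blast
qed

end

section \<open>Counting functions by their restrictions to blocks\<close>

lemma card_restrict_blocks:
  fixes lab :: "'a \<Rightarrow> 'b"
  assumes "finite A" "finite F" "inj_on (\<lambda>f. restrict f A) F"
  shows "card F \<le> (\<Prod>i\<in>lab ` A. card ((\<lambda>f. restrict f {a\<in>A. lab a = i}) ` F))"
proof -
  \<comment> \<open>The family of restrictions to the fibres of \<open>lab\<close> determines the
    restriction to \<open>A\<close> and lies in a finite product.\<close>
  define G where "G f = (\<lambda>i\<in>lab ` A. restrict f {a\<in>A. lab a = i})" for f :: "'a \<Rightarrow> 'c"
  have "inj_on G F"
  proof (rule inj_onI)
    fix f g assume fg: "f \<in> F" "g \<in> F" "G f = G g"
    have "f a = g a" if a: "a \<in> A" for a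
    proof -
      have "G f (lab a) a = G g (lab a) a" using fg by simp
      then show ?thesis using a by (simp add: G_def)
    qed
    then have "restrict f A = restrict g A" by (auto simp: restrict_def)
    then show "f = g" using assms(3) fg by (auto dest: inj_onD)
  qed
  then have "card F = card (G ` F)" by (simp add: card_image)
  also have "\<dots> \<le> card (PiE (lab ` A) (\<lambda>i. (\<lambda>f. restrict f {a\<in>A. lab a = i}) ` F))"
    using assms by (intro card_mono finite_PiE) (auto simp: G_def)
  also have "\<dots> = (\<Prod>i\<in>lab ` A. card ((\<lambda>f. restrict f {a\<in>A. lab a = i}) ` F))"
    using assms by (simp add: card_PiE)
  finally show ?thesis .
qed

text \<open>Here \<open>t f\<close> is a summary of \<open>f\<close> that determines it on
  \<open>B\<close>, so there are no more restrictions than possible summaries.\<close>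

lemma card_restrict_le:
  assumes "finite G" "\<And>f. f \<in> F \<Longrightarrow> t f \<in> G"
    and eq: "\<And>f g b. f \<in> F \<Longrightarrow> g \<in> F \<Longrightarrow> t f = t g \<Longrightarrow> b \<in> B \<Longrightarrow> f b = g b"
  shows "card ((\<lambda>f. restrict f B) ` F) \<le> card G"
proof -
  have "restrict f B = restrict (inv_into F t (t f)) B" if f: "f \<in> F" for f
  proof (rule restrict_ext)
    fix b assume b: "b \<in> B"
    have "inv_into F t (t f) \<in> F" by (rule inv_into_into) (rule imageI[OF f])
    moreover have "t f = t (inv_into F t (t f))"
      using f by (simp add: f_inv_into_f)
    ultimately show "f b = inv_into F t (t f) b" using f b by (intro eq)
  qed
  then have "(\<lambda>f. restrict f B) ` F \<subseteq> (\<lambda>y. restrict (inv_into F t y) B) ` G"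
    using assms(2) by blast
  then show ?thesis using assms(1) by (rule surj_card_le[rotated])
qed

section \<open>Options per pair of residues\<close>

text \<open>The possible Kunz coordinates of a residue and its mirror, both of height \<open>q\<close>.\<close>

definition pairs :: "nat \<Rightarrow> (nat \<times> nat) set" where
  "pairs q = (SIGMA a:{1..q + 1}. {max 1 (q + 1 - a)..q + 1})"

lemma finite_pairs [simp]: "finite (pairs q)"
  by (simp add: pairs_def)

text \<open>A first coordinate \<open>a \<le> q\<close> leaves \<open>a + 1\<close> choices for the
  second; \<open>a = q + 1\<close> leaves only \<open>q + 1\<close>, since coordinates start at
  1.\<close>

lemma card_pairs: "2 * card (pairs q) = q\<^sup>2 + 5 * q + 2"
proof -
  have "(\<Sum>a=1..q. card {max 1 (q + 1 - a)..q + 1}) = (\<Sum>a=1..q. a + 1)"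
    by (rule sum.cong) auto
  also have "2 * \<dots> = q\<^sup>2 + 3 * q"
    by (induction q) (auto simp: power2_eq_square)
  finally show ?thesis by (simp add: pairs_def)
qed

text \<open>Two residues of height \<open>q\<close> account for \<open>2 * (q + 1)\<close> numbers,
  so the critical rate allows \<open>2 ^ (q + 1)\<close> options. Equality holds for
  \<open>q = 1\<close> and \<open>q = 2\<close>: these heights give no gain by themselves.\<close>

lemma card_pairs_le: "real (card (pairs q)) \<le> 2 ^ (q + 1)"
proof -
  consider "q = 0" | "q = 1" | "2 \<le> q" by linarith
  then have "q\<^sup>2 + 5 * q + 2 \<le> 2 * 2 ^ (q + 1)"
  proof cases
    case 3
    then show ?thesis
      by (induction q rule: nat_induct_at_least) (auto simp: power2_eq_square)
  qed auto
  then have "card (pairs q) \<le> 2 ^ (q + 1)" using card_pairs[of q] by linarith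
  then show ?thesis by (metis of_nat_le_iff of_nat_numeral of_nat_power)
qed

text \<open>Height 3 has 13 options where the critical rate allows 16; from there on the quadratic
  grows by a factor below \<open>c\<close> per step. The factor \<open>99/100\<close> is squared
  because a pair carries two weights.\<close>

lemma card_pairs_le_gain:
  assumes "3 \<le> q"
  shows "real (card (pairs q)) \<le> (2 * (99/100)\<^sup>2) ^ (q + 1)"
proof -
  define c :: real where "c = 2 * (99/100)\<^sup>2"
  have c: "c = 19602 / 10000" by (simp add: c_def power2_eq_square)
  have "real (q\<^sup>2 + 5 * q + 2) \<le> 2 * c ^ (q + 1)" using assms
  proof (induction q rule: nat_induct_at_least)
    case base
    then show ?case by (simp add: c eval_nat_numeral)
  next
    case (Suc q)
    have sq: "3 \<le> real q" "3 * real q \<le> real q * real q"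
      using Suc.hyps by (simp_all add: mult_right_mono)
    have "real ((Suc q)\<^sup>2 + 5 * Suc q + 2) = real q * real q + 7 * real q + 8"
      by (simp add: power2_eq_square algebra_simps)
    also have "\<dots> \<le> c * (real q * real q) + c * (5 * real q) + c * 2"
      using sq unfolding c by linarith
    also have "\<dots> = c * real (q\<^sup>2 + 5 * q + 2)"
      by (simp add: power2_eq_square distrib_left)
    also have "\<dots> \<le> c * (2 * c ^ (q + 1))"
      using Suc.IH by (intro mult_left_mono) (auto simp: c)
    also have "\<dots> = 2 * c ^ (Suc q + 1)" by simp
    finally show ?case .
  qed
  then show ?thesis using card_pairs[of q] unfolding c_def by linarith
qed

text \<open>An explicit list lets simplification count the options that survive a side
  condition.\<close>

lemma pairs_two: "pairs 2 \<subseteq> set [(1,2), (1,3), (2,1), (2,2), (2,3), (3,1), (3,2), (3,3)]"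
proof
  fix p assume "p \<in> pairs 2"
  then obtain a b where p: "p = (a, b)" and ab: "1 \<le> a" "a \<le> 3" "1 \<le> b" "b \<le> 3" "3 \<le> a + b"
    by (cases p) (auto simp: pairs_def)
  from ab have "a = 1 \<or> a = 2 \<or> a = 3" "b = 1 \<or> b = 2 \<or> b = 3" by linarith+
  then show "p \<in> set [(1,2), (1,3), (2,1), (2,2), (2,3), (3,1), (3,2), (3,3)]"
    using p ab(5) by (elim disjE) simp_all
qed

lemma card_Collect_le_length:
  assumes "A \<subseteq> set xs"
  shows "card {x \<in> A. Q x} \<le> length (filter Q xs)"
proof -
  have "{x \<in> A. Q x} \<subseteq> set (filter Q xs)" using assms by auto
  then show ?thesis by (meson card_length card_mono finite_set le_trans)
qed

lemma card_pairs_off_one: "card {p \<in> pairs 2. fst p \<noteq> 1} \<le> 6"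
  using card_Collect_le_length[OF pairs_two, of "\<lambda>p. fst p \<noteq> 1"] by simp

lemma card_pairs_self: "card {p \<in> pairs 2. fst p = 1 \<longrightarrow> snd p \<le> 2} \<le> 7"
  using card_Collect_le_length[OF pairs_two, of "\<lambda>p. fst p = 1 \<longrightarrow> snd p \<le> 2"] by simp

text \<open>
  If \<open>m + a \<in> X\<close>, then \<open>m + r \<in> X\<close> forces \<open>2 * m + r + a \<in> X\<close>. This couples the pair of \<open>r\<close>
  with the pair of \<open>R - a - r\<close>, whose mirror is \<open>r + a\<close>, and leaves 53 of the 64 options.
\<close>

definition quads :: "((nat \<times> nat) \<times> (nat \<times> nat)) set" where
  "quads = {z \<in> pairs 2 \<times> pairs 2.
    (fst (fst z) = 1 \<longrightarrow> snd (snd z) \<le> 2) \<and> (fst (snd z) = 1 \<longrightarrow> snd (fst z) \<le> 2)}"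

lemma finite_quads [simp]: "finite quads"
  by (rule finite_subset[of _ "pairs 2 \<times> pairs 2"]) (auto simp: quads_def)

text \<open>Each of the two implications excludes 2 * 3 of the 64 options, and exactly one option
  violates both.\<close>

lemma card_quads: "card quads \<le> 53"
proof -
  let ?ps = "[(1,2), (1,3), (2,1), (2,2), (2,3), (3,1), (3,2), (3,3)] :: (nat \<times> nat) list"
  have "pairs 2 \<times> pairs 2 \<subseteq> set (List.product ?ps ?ps)"
    using pairs_two unfolding set_product by (intro Sigma_mono)
  from card_Collect_le_length[OF this, of "\<lambda>z. (fst (fst z) = 1 \<longrightarrow> snd (snd z) \<le> 2) \<and> (fst (snd z) = 1 \<longrightarrow> snd (fst z) \<le> 2)"]
  show ?thesis unfolding quads_def by simp
qed

section \<open>Weights and the product bound over blocks\<close>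

context window
begin

text \<open>
  The critical rate is a factor \<open>sqrt 2\<close> for each number \<open>x \<le> n\<close>; the residues satisfying \<open>P\<close> are those
  on which a gain is claimed.
\<close>

definition wt :: "(nat \<Rightarrow> bool) \<Rightarrow> nat \<Rightarrow> real" where
  "wt P r = (sqrt 2 * (if P r then 99/100 else 1)) ^ (ht r + 1)"

lemma wt_nonneg [simp]: "0 \<le> wt P r"
  by (simp add: wt_def)

lemma wt_sq: "wt P r * wt P r = (if P r then (2 * (99/100)\<^sup>2) ^ (ht r + 1) else 2 ^ (ht r + 1))"
proof -
  have *: "(sqrt 2 * w) ^ k * (sqrt 2 * w) ^ k = (2 * w\<^sup>2) ^ k" for w :: real and k :: nat
  proof -
    have "(sqrt 2 * w) ^ k * (sqrt 2 * w) ^ k = ((sqrt 2)\<^sup>2 * w\<^sup>2) ^ k"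
      by (simp only: power_mult_distrib[symmetric] power2_eq_square mult_ac)
    then show ?thesis by simp
  qed
  show ?thesis unfolding wt_def * by simp
qed

text \<open>The class of \<open>r\<close> has exactly \<open>ht r + 1\<close> members up to
  \<open>n\<close>. Hence each \<open>x \<le> n\<close> contributes one factor
  \<open>sqrt 2\<close>, and a further \<open>99/100\<close> if its residue gains.\<close>

lemma prod_wt: "(\<Prod>r<m. wt P r) = sqrt 2 ^ (n + 1) * (99/100) ^ card {x. x \<le> n \<and> P (x mod m)}"
proof -
  define h :: "nat \<Rightarrow> real" where "h x = sqrt 2 * (if P (x mod m) then 99/100 else 1)" for x
  have "(\<Prod>x\<in>{x \<in> {..n}. x mod m = r}. h x) = wt P r" if r: "r < m" for r
  proof -
    have "{x \<in> {..n}. x mod m = r} = (\<lambda>k. r + m * k) ` {..ht r}" (is "?L = ?R")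
    proof
      show "?L \<subseteq> ?R"
      proof
        fix x assume x: "x \<in> ?L"
        then have "x = r + m * (x div m)" by auto
        moreover from this have "x div m \<le> ht r" using le_n_iff[OF r, of "x div m"] x by simp
        ultimately show "x \<in> ?R" by blast
      qed
      show "?R \<subseteq> ?L" using r le_n_iff[OF r] by auto
    qed
    moreover have "inj_on (\<lambda>k. r + m * k) {..ht r}" using m_pos by (auto simp: inj_on_def)
    ultimately have "card {x \<in> {..n}. x mod m = r} = ht r + 1" by (simp add: card_image)
    moreover have "(\<Prod>x\<in>{x \<in> {..n}. x mod m = r}. h x) =
      (\<Prod>x\<in>{x \<in> {..n}. x mod m = r}. sqrt 2 * (if P r then 99/100 else 1))"
      by (rule prod.cong) (auto simp: h_def)
    ultimately show ?thesis by (simp add: wt_def)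
  qed
  then have "(\<Prod>r<m. wt P r) = (\<Prod>r<m. \<Prod>x\<in>{x \<in> {..n}. x mod m = r}. h x)" by simp
  also have "\<dots> = (\<Prod>x\<le>n. h x)" using m_pos by (intro prod.group) auto
  also have "\<dots> = sqrt 2 ^ (n + 1) * (\<Prod>x\<le>n. if P (x mod m) then 99/100 else 1)"
    by (simp add: h_def prod.distrib)
  also have "(\<Prod>x\<le>n. if P (x mod m) then 99/100 else (1::real)) = (\<Prod>x\<in>{x. x \<le> n \<and> P (x mod m)}. 99/100)"
    by (subst prod.inter_filter[symmetric]) (auto intro: prod.cong)
  finally show ?thesis by simp
qed

text \<open>The pattern of all upper bounds below: partition the residues into blocks and compare
  the options of each block with its weight.\<close>

lemma card_le_blocks:
  fixes lab :: "nat \<Rightarrow> 'b"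
  assumes F: "F \<subseteq> truncations_min n m"
    and blocks: "\<And>r. r < m \<Longrightarrow> real (card ((\<lambda>f. restrict f {s \<in> {..<m}. lab s = lab r}) ` kunz ` F))
      \<le> (\<Prod>s\<in>{s \<in> {..<m}. lab s = lab r}. wt P s)"
  shows "real (card F) \<le> sqrt 2 ^ (n + 1) * (99/100) ^ card {x. x \<le> n \<and> P (x mod m)}"
proof -
  \<comment> \<open>Injectivity of the composite yields both that of \<open>kunz\<close> on
    \<open>F\<close> and that of restriction on the image.\<close>
  have inj: "inj_on ((\<lambda>f. restrict f {..<m}) \<circ> kunz) F"
    using inj_on_subset[OF inj_on_kunz F] by (simp add: o_def)
  have finF: "finite F" by (rule finite_subset[OF F finite_truncations_min])
  have "card F = card (kunz ` F)" using inj_on_imageI2[OF inj] by (simp add: card_image)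
  also have "\<dots> \<le> (\<Prod>i\<in>lab ` {..<m}. card ((\<lambda>f. restrict f {s \<in> {..<m}. lab s = i}) ` kunz ` F))"
    using inj_on_imageI[OF inj] finF by (intro card_restrict_blocks) auto
  finally have "real (card F) \<le> real (\<Prod>i\<in>lab ` {..<m}. card ((\<lambda>f. restrict f {s \<in> {..<m}. lab s = i}) ` kunz ` F))"
    by (simp only: of_nat_le_iff)
  also have "\<dots> \<le> (\<Prod>i\<in>lab ` {..<m}. \<Prod>s\<in>{s \<in> {..<m}. lab s = i}. wt P s)"
    unfolding of_nat_prod using blocks by (intro prod_mono) auto
  also have "\<dots> = (\<Prod>r<m. wt P r)" by (intro prod.group) auto
  finally show ?thesis unfolding prod_wt .
qed

lemma kunz_pairs:
  assumes "X \<in> truncations_min n m" "r < m"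
  shows "(kunz X r, kunz X (mirror r)) \<in> pairs (ht r)"
  using kunz_pos[OF assms] kunz_le[OF assms(1), of r] kunz_pos[OF assms(1) mirror_less, of r]
    kunz_le[OF assms(1), of "mirror r"] kunz_mirror[OF assms] ht_mirror[OF assms(2)]
  by (auto simp: pairs_def)

lemma card_block_pair:
  assumes "finite T" "\<And>X. X \<in> F \<Longrightarrow> (kunz X r, kunz X s) \<in> T"
  shows "card ((\<lambda>f. restrict f {r, s}) ` kunz ` F) \<le> card T"
  using assms by (intro card_restrict_le[where t = "\<lambda>f. (f r, f s)"]) auto

text \<open>For mirror pairs where only \<open>kunz_pairs\<close> is exploited; a gain must then
  come from height at least 3.\<close>

lemma card_block_default:
  assumes F: "F \<subseteq> truncations_min n m" and r: "r < m"
    and P: "P (mirror r) = P r" "P r \<Longrightarrow> 3 \<le> ht r"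
  shows "real (card ((\<lambda>f. restrict f {r, mirror r}) ` kunz ` F)) \<le> (\<Prod>s\<in>{r, mirror r}. wt P s)"
proof -
  have le: "real (card (pairs (ht r))) \<le> wt P r * wt P r"
    unfolding wt_sq using P(2) card_pairs_le card_pairs_le_gain by simp
  show ?thesis
  proof (cases "mirror r = r")
    case False
    have "card ((\<lambda>f. restrict f {r, mirror r}) ` kunz ` F) \<le> card (pairs (ht r))"
      using F kunz_pairs r by (intro card_block_pair) auto
    moreover have "wt P (mirror r) = wt P r" using P(1) r by (simp add: wt_def ht_mirror)
    ultimately show ?thesis using False le by (simp add: order_trans[OF of_nat_mono])
  next
    case True
    \<comment> \<open>A residue that is its own mirror carries a single weight. Any two values in
      \<open>D\<close> form an admissible pair, so the bound for pairs is the square of the bound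
      needed.\<close>
    define D where "D = {a \<in> {1..ht r + 1}. ht r < a + a}"
    have "D \<times> D \<subseteq> pairs (ht r)" by (auto simp: D_def pairs_def)
    then have "card D * card D \<le> card (pairs (ht r))"
      unfolding card_cartesian_product[symmetric] by (intro card_mono) auto
    then have "(real (card D))\<^sup>2 \<le> (wt P r)\<^sup>2"
      using le unfolding power2_eq_square by (metis of_nat_le_iff of_nat_mult order_trans)
    then have D: "real (card D) \<le> wt P r" by (rule power2_le_imp_le) simp
    have "(kunz X r, kunz X r) \<in> (\<lambda>a. (a, a)) ` D" if "X \<in> F" for X
      using kunz_pairs[OF _ r, of X] kunz_mirror[OF _ r, of X] F that True
      by (intro image_eqI[of _ _ "kunz X r"]) (auto simp: D_def pairs_def)
    then have "card ((\<lambda>f. restrict f {r, r}) ` kunz ` F) \<le> card ((\<lambda>a. (a, a)) ` D)"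
      by (intro card_block_pair) (simp_all add: D_def)
    also have "\<dots> = card D" by (intro card_image) (auto simp: inj_on_def)
    finally show ?thesis using True D by simp
  qed
qed

end

section \<open>Counting by the smallest element\<close>

context window
begin

text \<open>A canonical representative of a mirror pair, so that the fibres of \<open>base\<close>
  are the blocks.\<close>

definition base :: "nat \<Rightarrow> nat" where "base r = min r (mirror r)"

lemma base_less: "r < m \<Longrightarrow> base r < m"
  by (simp add: base_def)

lemma base_mirror: "r < m \<Longrightarrow> base (mirror r) = base r"
  by (simp add: base_def mirror_mirror min.commute)

lemma base_eq_iff:
  assumes "r < m" "s < m"
  shows "base s = base r \<longleftrightarrow> s = r \<or> s = mirror r"
proof
  assume "base s = base r"
  then have "s = r \<or> s = mirror r \<or> mirror s = r \<or> mirror s = mirror r"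
    by (auto simp: base_def min_def split: if_splits)
  then show "s = r \<or> s = mirror r" using assms mirror_mirror by metis
qed (use assms base_mirror in auto)

lemma base_fibre: "r < m \<Longrightarrow> {s \<in> {..<m}. base s = base r} = {r, mirror r}"
  using base_eq_iff mirror_less by auto

lemma mirror_set_base: "r < m \<Longrightarrow> {r, mirror r} = {base r, mirror (base r)}"
  by (auto simp: base_def min_def mirror_mirror)

definition R :: nat where "R = n - 2 * m"

lemma n_eq: "n = 2 * m + R"
  using two_m by (simp add: R_def)

text \<open>Here \<open>x \<le> R / 16\<close> gives \<open>x + m \<le> R\<close>, hence
  \<open>x + 3 * m \<le> n\<close>: the residues of all these \<open>x\<close> have height at least
  3. The exponent is weakened so that all cases share one bound.\<close>

lemma card_wide:
  assumes "16 * m < 15 * R"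
  shows "real (card (truncations_min n m)) \<le> sqrt 2 ^ (n + 1) * (99/100) ^ (R div 16 - 1)"
proof -
  let ?P = "\<lambda>r. 3 \<le> ht r"
  have "{..R div 16} \<subseteq> {x. x \<le> n \<and> ?P (x mod m)}"
  proof
    fix x assume "x \<in> {..R div 16}"
    then have "x \<le> R div 16" by simp
    then have "x + m \<le> R" using assms by linarith
    then have x: "x + m * 3 \<le> n" using n_eq by linarith
    then have "x mod m + m * 3 \<le> n" using mod_less_eq_dividend[of x m] by linarith
    then have "?P (x mod m)" using le_n_iff m_pos by simp
    then show "x \<in> {x. x \<le> n \<and> ?P (x mod m)}" using x by simp
  qed
  then have "card {..R div 16} \<le> card {x. x \<le> n \<and> ?P (x mod m)}" by (intro card_mono) auto
  then have le: "R div 16 - 1 \<le> card {x. x \<le> n \<and> ?P (x mod m)}" by simp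
  have "real (card (truncations_min n m)) \<le> sqrt 2 ^ (n + 1) * (99/100) ^ card {x. x \<le> n \<and> ?P (x mod m)}"
  proof (rule card_le_blocks[where lab = base])
    fix r assume r: "r < m"
    show "real (card ((\<lambda>f. restrict f {s \<in> {..<m}. base s = base r}) ` kunz ` truncations_min n m))
      \<le> (\<Prod>s\<in>{s \<in> {..<m}. base s = base r}. wt ?P s)"
      unfolding base_fibre[OF r] using r by (intro card_block_default) (auto simp: ht_mirror)
  qed simp
  also have "\<dots> \<le> sqrt 2 ^ (n + 1) * (99/100) ^ (R div 16 - 1)"
    using le by (intro mult_left_mono power_decreasing) auto
  finally show ?thesis .
qed

section \<open>The narrow case, where only height 2 is available for a gain\<close>

context
  assumes narrow: "15 * R \<le> 16 * m"
begin

text \<open>Both \<open>r\<close> and \<open>R - r\<close> lie below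
  \<open>15 * R / 16 \<le> m\<close>, and \<open>r + (R - r) + 2 * m = n\<close>.\<close>

lemma middle:
  assumes "R < 16 * r" "16 * r < 15 * R"
  shows "r < m" "mirror r = R - r" "ht r = 2"
proof -
  show "r < m" using assms narrow by linarith
  have "r + (R - r) + m * 2 = n" using n_eq assms by linarith
  moreover have "R - r < m" using assms narrow by linarith
  ultimately show "mirror r = R - r" "ht r = 2" using ht_mirrorI by blast+
qed

text \<open>The exact value is \<open>8 * (99/100) ^ 6\<close>, about 7.53. The constant 7.5 exceeds
  the option counts 6 and 7, and its square 56.25 exceeds the 53 of \<open>quads\<close>.\<close>

lemma wt_gain_two: "P r \<Longrightarrow> ht r = 2 \<Longrightarrow> wt P r * wt P r \<ge> 7.5"
  unfolding wt_sq by (simp add: power2_eq_square eval_nat_numeral)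

text \<open>Coordinate 1 at \<open>a\<close> means \<open>m + a \<in> X\<close>. If this fails
  throughout the range, each mirror pair meeting it keeps at most 6 of its 8 options.\<close>

lemma card_no_kunz_one:
  "real (card {X \<in> truncations_min n m. \<forall>a. 7 * R < 16 * a \<and> 2 * a < R \<longrightarrow> kunz X a \<noteq> 1})
    \<le> sqrt 2 ^ (n + 1) * (99/100) ^ (R div 16 - 1)" (is "real (card ?F) \<le> _")
proof -
  \<comment> \<open>The interval is symmetric under \<open>s \<mapsto> R - s\<close>. Its midpoint
    is removed: it is its own mirror and the hypothesis says nothing about it.\<close>
  define P where "P s \<longleftrightarrow> 7 * R < 16 * s \<and> 16 * s < 9 * R \<and> 2 * s \<noteq> R" for s
  have P_mid: "R < 16 * s" "16 * s < 15 * R" if "P s" for s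
    using that unfolding P_def by linarith+
  have P_mirror: "P (mirror s)" if "P s" for s
    using that unfolding middle(2)[OF P_mid[OF that]] P_def by linarith
  define d where "d = R div 16"
  \<comment> \<open>The lower half of the interval already suffices; taking \<open>d - 1\<close>
    terms keeps them strictly below \<open>R / 2\<close>. They are smaller than \<open>m\<close>,
    hence their own residues.\<close>
  have "(\<lambda>i. (7 * R) div 16 + 1 + i) ` {..<d - 1} \<subseteq> {x. x \<le> n \<and> P (x mod m)}"
  proof
    fix x assume "x \<in> (\<lambda>i. (7 * R) div 16 + 1 + i) ` {..<d - 1}"
    then obtain i where i: "i < d - 1" "x = (7 * R) div 16 + 1 + i" by auto
    then have "7 * R < 16 * x" "16 * x < 8 * R" unfolding d_def by linarith+
    then have "P x" by (simp add: P_def)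
    then show "x \<in> {x. x \<le> n \<and> P (x mod m)}"
      using middle(1)[OF P_mid[OF \<open>P x\<close>]] two_m by simp
  qed
  then have "card ((\<lambda>i. (7 * R) div 16 + 1 + i) ` {..<d - 1}) \<le> card {x. x \<le> n \<and> P (x mod m)}"
    by (intro card_mono) auto
  then have le: "R div 16 - 1 \<le> card {x. x \<le> n \<and> P (x mod m)}"
    by (subst (asm) card_image) (auto simp: d_def)
  have "real (card ?F) \<le> sqrt 2 ^ (n + 1) * (99/100) ^ card {x. x \<le> n \<and> P (x mod m)}"
  proof (rule card_le_blocks[where lab = base])
    fix r assume r: "r < m"
    show "real (card ((\<lambda>f. restrict f {s \<in> {..<m}. base s = base r}) ` kunz ` ?F))
      \<le> (\<Prod>s\<in>{s \<in> {..<m}. base s = base r}. wt P s)"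
    proof (cases "P r")
      case False
      then have "\<not> P (mirror r)" using P_mirror mirror_mirror[OF r] by metis
      then show ?thesis unfolding base_fibre[OF r]
        using False r by (intro card_block_default) auto
    next
      case True
      \<comment> \<open>The smaller member of the pair lies below \<open>R / 2\<close>, where
        coordinate 1 is forbidden.\<close>
      define u where "u = base r"
      have u: "u < m" "{r, mirror r} = {u, mirror u}"
        using r by (auto simp: u_def base_less mirror_set_base)
      have Pu: "P u" using True P_mirror by (auto simp: u_def base_def min_def)
      note mid = middle[OF P_mid[OF Pu]]
      have "u \<le> mirror u" unfolding u_def using base_mirror[OF r] r mirror_mirror[OF r]
        by (auto simp: base_def min_def)
      then have u_less: "2 * u < R" using mid Pu unfolding P_def by auto
      have "(kunz X u, kunz X (mirror u)) \<in> {p \<in> pairs 2. fst p \<noteq> 1}" if "X \<in> ?F" for X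
        using that kunz_pairs[of X u] u mid Pu u_less unfolding P_def by auto
      then have "card ((\<lambda>f. restrict f {u, mirror u}) ` kunz ` ?F) \<le> card {p \<in> pairs 2. fst p \<noteq> 1}"
        by (intro card_block_pair) auto
      also have "\<dots> \<le> 6" by (rule card_pairs_off_one)
      finally have "real (card ((\<lambda>f. restrict f {u, mirror u}) ` kunz ` ?F)) \<le> 6" by simp
      also have "\<dots> \<le> wt P u * wt P u" using wt_gain_two[of P u, OF Pu mid(3)] by simp
      also have "\<dots> = (\<Prod>s\<in>{u, mirror u}. wt P s)"
        using u_less mid(2) P_mirror[OF Pu] Pu ht_mirror[OF u(1)] by (simp add: wt_def)
      finally show ?thesis unfolding base_fibre[OF r] u(2) .
    qed
  qed auto
  also have "\<dots> \<le> sqrt 2 ^ (n + 1) * (99/100) ^ (R div 16 - 1)"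
    using le by (intro mult_left_mono power_decreasing) auto
  finally show ?thesis .
qed

text \<open>Given \<open>m + a \<in> X\<close>, the mirror pairs of \<open>u\<close> and
  \<open>R - a - u\<close> are coupled as in \<open>quads\<close>, so blocks of up to four residues
  gain.\<close>

lemma card_kunz_one:
  assumes a: "7 * R < 16 * a" "2 * a < R"
  shows "real (card {X \<in> truncations_min n m. kunz X a = 1})
    \<le> sqrt 2 ^ (n + 1) * (99/100) ^ (R div 16 - 1)" (is "real (card ?F) \<le> _")
proof -
  \<comment> \<open>The interval is invariant under \<open>\<sigma>\<close>. Since
    \<open>a > 7 * R / 16\<close>, it lies below \<open>R / 2\<close>, so its members represent
    their mirror pairs; since \<open>a < R / 2\<close>, more than enough of them remain.\<close>
  define zone where "zone u \<longleftrightarrow> R < 16 * u \<and> 16 * u + 16 * a < 15 * R" for u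
  define \<sigma> where "\<sigma> u = R - a - u" for u
  \<comment> \<open>Merges the pairs of \<open>u\<close> and \<open>\<sigma> u\<close> inside the
    zone. As \<open>\<sigma>\<close> preserves the zone, these labels never meet those of the
    uncoupled pairs.\<close>
  define lab where "lab s = (if zone (base s) then min (base s) (\<sigma> (base s)) else base s)" for s
  define P where "P s \<longleftrightarrow> zone (base s)" for s
  have zone_\<sigma>: "zone (\<sigma> u)" "\<sigma> (\<sigma> u) = u" "\<sigma> u + u + a = R" if "zone u" for u
    using that a unfolding zone_def \<sigma>_def by linarith+
  have zone_mid: "u < m" "mirror u = R - u" "ht u = 2" if "zone u" for u
    using middle[of u] that a unfolding zone_def by auto
  have zone_half: "2 * u < R" if "zone u" for u
    using that a unfolding zone_def by linarith
  have base_zone: "base u = u" if "zone u" for u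
    using zone_mid[OF that] zone_half[OF that] by (simp add: base_def)
  have P_zone: "P u" "P (mirror u)" if "zone u" for u
    using that base_zone base_mirror zone_mid(1) by (simp_all add: P_def)
  have wt_zone: "wt P (mirror u) = wt P u" "wt P u * wt P u \<ge> 7.5" "mirror u \<noteq> u" if "zone u" for u
  proof -
    show "wt P (mirror u) = wt P u"
      using P_zone[OF that] ht_mirror zone_mid(1)[OF that] by (simp add: wt_def)
    show "wt P u * wt P u \<ge> 7.5" using wt_gain_two P_zone(1) zone_mid(3) that by blast
    show "mirror u \<noteq> u" using zone_mid(2) zone_half that by force
  qed
  define d where "d = R div 16"
  have "(\<lambda>i. R div 16 + 1 + i) ` {..<d - 1} \<subseteq> {x. x \<le> n \<and> P (x mod m)}"
  proof
    fix x assume "x \<in> (\<lambda>i. R div 16 + 1 + i) ` {..<d - 1}"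
    then obtain i where i: "i < d - 1" "x = R div 16 + 1 + i" by auto
    then have "zone x" using a unfolding zone_def d_def by linarith
    then show "x \<in> {x. x \<le> n \<and> P (x mod m)}"
      using zone_mid(1)[of x] P_zone(1)[of x] two_m by simp
  qed
  then have "card ((\<lambda>i. R div 16 + 1 + i) ` {..<d - 1}) \<le> card {x. x \<le> n \<and> P (x mod m)}"
    by (intro card_mono) auto
  then have le: "R div 16 - 1 \<le> card {x. x \<le> n \<and> P (x mod m)}"
    by (subst (asm) card_image) (auto simp: d_def)
  \<comment> \<open>The point is that \<open>u + a\<close> is the mirror of
    \<open>\<sigma> u\<close> and has height 2, so \<open>kunz_add\<close> applies.\<close>
  have kunz_\<sigma>: "kunz X (mirror (\<sigma> u)) \<le> 2" if "X \<in> ?F" "zone u" "kunz X u = 1" for X u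
  proof -
    have z: "zone (\<sigma> u)" and "u + a = R - \<sigma> u" using zone_\<sigma>[OF that(2)] by auto
    then have eq: "u + a = mirror (\<sigma> u)" using zone_mid(2) by simp
    have "ht (u + a) = 2" unfolding eq using ht_mirror[OF zone_mid(1)[OF z]] zone_mid(3)[OF z] by simp
    then show ?thesis using kunz_add[of X u a] that mirror_less[of "\<sigma> u"] eq by auto
  qed
  have "real (card ?F) \<le> sqrt 2 ^ (n + 1) * (99/100) ^ card {x. x \<le> n \<and> P (x mod m)}"
  proof (rule card_le_blocks[where lab = lab])
    fix r assume r: "r < m"
    define u where "u = base r"
    have um: "u < m" using r by (simp add: u_def base_less)
    have fibre_u: "{s \<in> {..<m}. base s = w} = {w, mirror w}" if "base w = w" "w < m" for w
      using base_fibre[OF that(2)] that(1) by simp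
    have bu: "base u = u" using base_eq_iff[OF r um] r base_mirror
      by (auto simp: u_def base_def min_def mirror_mirror)
    show "real (card ((\<lambda>f. restrict f {s \<in> {..<m}. lab s = lab r}) ` kunz ` ?F))
      \<le> (\<Prod>s\<in>{s \<in> {..<m}. lab s = lab r}. wt P s)"
    proof (cases "zone u")
      case False
      have "lab s = lab r \<longleftrightarrow> base s = u" if "s < m" for s
        using False zone_\<sigma>(1)[of "base s"] unfolding lab_def u_def by (auto simp: min_def split: if_splits)
      then have B: "{s \<in> {..<m}. lab s = lab r} = {u, mirror u}"
        using fibre_u[OF bu um] by auto
      have "\<not> P u" "\<not> P (mirror u)" using False bu base_mirror[OF um] by (auto simp: P_def)
      then show ?thesis unfolding B using um by (intro card_block_default) auto
    next
      case True
      define v where "v = \<sigma> u"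
      have v: "zone v" "\<sigma> v = u" "v + u + a = R" using zone_\<sigma>[OF True] by (auto simp: v_def)
      have "lab s = lab r \<longleftrightarrow> base s = u \<or> base s = v" if "s < m" for s
      proof -
        have "lab s = lab r \<longleftrightarrow> zone (base s) \<and> min (base s) (\<sigma> (base s)) = min u v"
          using True v(1) unfolding lab_def u_def[symmetric] v_def[symmetric]
          by (auto simp: min_def split: if_splits)
        also have "\<dots> \<longleftrightarrow> base s = u \<or> base s = v" (is "?lhs \<longleftrightarrow> ?rhs")
        proof
          assume ?lhs
          moreover from this have "base s + \<sigma> (base s) = u + v"
            using zone_\<sigma>(3)[of "base s"] v(3) by linarith
          ultimately show ?rhs by (auto simp: min_def split: if_splits)
        next
          assume ?rhs
          then show ?lhs using True v(1,2) by (elim disjE) (simp_all add: v_def[symmetric] min.commute)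
        qed
        finally show ?thesis .
      qed
      then have B: "{s \<in> {..<m}. lab s = lab r} = {u, mirror u} \<union> {v, mirror v}"
        using fibre_u[OF bu um] fibre_u[OF base_zone[OF v(1)] zone_mid(1)[OF v(1)]] by blast
      show ?thesis
      proof (cases "u = v")
        \<comment> \<open>At a fixed point of \<open>\<sigma>\<close> the block is a single pair and
          the coupling ties its own two coordinates.\<close>
        case eq: True
        then have "\<sigma> u = u" by (simp add: v_def)
        then have "(kunz X u, kunz X (mirror u)) \<in> {p \<in> pairs 2. fst p = 1 \<longrightarrow> snd p \<le> 2}" if "X \<in> ?F" for X
          using kunz_pairs[of X u] kunz_\<sigma>[OF that True] that um zone_mid(3)[OF True] by auto
        then have "card ((\<lambda>f. restrict f {u, mirror u}) ` kunz ` ?F)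
            \<le> card {p \<in> pairs 2. fst p = 1 \<longrightarrow> snd p \<le> 2}"
          by (intro card_block_pair) auto
        also have "\<dots> \<le> 7" by (rule card_pairs_self)
        finally have "real (card ((\<lambda>f. restrict f {u, mirror u}) ` kunz ` ?F)) \<le> 7" by simp
        also have "\<dots> \<le> wt P u * wt P u" using wt_zone(2)[OF True] by simp
        also have "\<dots> = (\<Prod>s\<in>{u, mirror u}. wt P s)"
          using wt_zone[OF True] by simp
        finally show ?thesis unfolding B eq[symmetric] Un_absorb .
      next
        case False
        let ?t = "\<lambda>f. ((f u, f (mirror u)), (f v, f (mirror v)))"
        have "?t (kunz X) \<in> quads" if "X \<in> ?F" for X
        proof -
          have "(kunz X u, kunz X (mirror u)) \<in> pairs 2" "(kunz X v, kunz X (mirror v)) \<in> pairs 2"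
            using kunz_pairs[of X u] kunz_pairs[of X v] that zone_mid(1,3) True v(1) by auto
          moreover have "kunz X u = 1 \<Longrightarrow> kunz X (mirror v) \<le> 2" "kunz X v = 1 \<Longrightarrow> kunz X (mirror u) \<le> 2"
            using kunz_\<sigma>[OF that True] kunz_\<sigma>[OF that v(1)] v(2) by (simp_all add: v_def)
          ultimately show ?thesis by (simp add: quads_def)
        qed
        then have "card ((\<lambda>f. restrict f ({u, mirror u} \<union> {v, mirror v})) ` kunz ` ?F) \<le> card quads"
          by (intro card_restrict_le[where t = ?t]) auto
        also have "\<dots> \<le> 53" by (rule card_quads)
        finally have "real (card ((\<lambda>f. restrict f ({u, mirror u} \<union> {v, mirror v})) ` kunz ` ?F)) \<le> 53"
          by simp
        also have "\<dots> \<le> (wt P u * wt P u) * (wt P v * wt P v)"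
          using mult_mono[OF wt_zone(2)[OF True] wt_zone(2)[OF v(1)]] by simp
        also have "\<dots> = (\<Prod>s\<in>{u, mirror u}. wt P s) * (\<Prod>s\<in>{v, mirror v}. wt P s)"
          using wt_zone[OF True] wt_zone[OF v(1)] by simp
        also have "\<dots> = (\<Prod>s\<in>{u, mirror u} \<union> {v, mirror v}. wt P s)"
          using False bu base_zone[OF v(1)] base_mirror[OF um] base_mirror[OF zone_mid(1)[OF v(1)]]
          by (intro prod.union_disjoint[symmetric]) auto
        finally show ?thesis unfolding B .
      qed
    qed
  qed auto
  also have "\<dots> \<le> sqrt 2 ^ (n + 1) * (99/100) ^ (R div 16 - 1)"
    using le by (intro mult_left_mono power_decreasing) auto
  finally show ?thesis .
qed

end

text \<open>In the narrow case at most \<open>R\<close> choices of \<open>a\<close>, together with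
  the case of no such \<open>a\<close>, cover everything; the linear factor is harmless against the
  geometric one.\<close>

lemma card_truncations_min_le_R:
  "real (card (truncations_min n m)) \<le> (real R + 1) * (sqrt 2 ^ (n + 1) * (99/100) ^ (R div 16 - 1))"
    (is "_ \<le> _ * ?b")
proof (cases "16 * m < 15 * R")
  case True
  have "1 * ?b \<le> (real R + 1) * ?b" by (intro mult_right_mono) auto
  then show ?thesis using card_wide[OF True] by linarith
next
  case False
  then have narrow: "15 * R \<le> 16 * m" by simp
  define A where "A = {a. 7 * R < 16 * a \<and> 2 * a < R}"
  have A: "A \<subseteq> {..<R}" by (auto simp: A_def)
  then have "finite A" "card A \<le> R" using finite_subset card_mono[OF _ A] by auto
  let ?E = "{X \<in> truncations_min n m. \<forall>a. 7 * R < 16 * a \<and> 2 * a < R \<longrightarrow> kunz X a \<noteq> 1}"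
  let ?F = "\<lambda>a. {X \<in> truncations_min n m. kunz X a = 1}"
  have "truncations_min n m = ?E \<union> (\<Union>a\<in>A. ?F a)" by (auto simp: A_def)
  then have "card (truncations_min n m) \<le> card ?E + (\<Sum>a\<in>A. card (?F a))"
    using card_Un_le[of ?E "\<Union>a\<in>A. ?F a"] card_UN_le[OF \<open>finite A\<close>, of ?F] by simp
  then have "real (card (truncations_min n m)) \<le> real (card ?E + (\<Sum>a\<in>A. card (?F a)))"
    by (rule of_nat_mono)
  also have "\<dots> = real (card ?E) + (\<Sum>a\<in>A. real (card (?F a)))" by simp
  also have "\<dots> \<le> ?b + (\<Sum>a\<in>A. ?b)"
    using card_no_kunz_one[OF narrow] card_kunz_one[OF narrow]
    by (intro add_mono sum_mono) (auto simp: A_def)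
  also have "\<dots> = (real (card A) + 1) * ?b" by (simp add: distrib_right)
  also have "\<dots> \<le> (real R + 1) * ?b"
    using \<open>card A \<le> R\<close> by (intro mult_right_mono) auto
  finally show ?thesis .
qed

end

lemma card_truncations_min_le:
  assumes "0 < m" "0 < R"
  shows "real (card (truncations_min (2 * m + R) m))
    \<le> (real R + 1) * (sqrt 2 ^ (2 * m + R + 1) * (99/100) ^ (R div 16 - 1))"
proof -
  interpret window "2 * m + R" m using assms by unfold_locales auto
  show ?thesis using card_truncations_min_le_R by (simp add: R_def)
qed

section \<open>Splitting by the minimum, and exact counts for large minimum\<close>

lemma truncations_upper: "Pow {N + 1..<2 * N + p} \<subseteq> truncations (2 * N + p)" if "p < 2"
proof
  fix X assume "X \<in> Pow {N + 1..<2 * N + p}"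
  then have X: "N + 1 \<le> x" "x < 2 * N + p" if "x \<in> X" for x using that by auto
  have "\<not> x + y \<le> 2 * N + p" if "x \<in> X" "y \<in> X" for x y
    using X(1)[OF that(1)] X(1)[OF that(2)] \<open>p < 2\<close> by linarith
  moreover have "X \<subseteq> {1..<2 * N + p}" using X by force
  ultimately show "X \<in> truncations (2 * N + p)" by (auto simp: truncations_def)
qed

text \<open>Sets above \<open>N\<close>, including the empty one, are unconstrained, as two elements
  sum to at least \<open>2 * N + 2\<close>. The others are indexed by the distance \<open>i\<close>
  from \<open>N\<close> to the minimum, which keeps \<open>R = 2 * i + p\<close> independent of
  \<open>N\<close>.\<close>

lemma card_truncations_split:
  assumes p: "p < 2"
  shows "card (truncations (2 * N + p)) =
    2 ^ (N + p - 1) + (\<Sum>i<N. card (truncations_min (2 * N + p) (N - i)))"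
proof -
  let ?n = "2 * N + p" and ?W = "\<lambda>i. truncations_min (2 * N + p) (N - i)"
  have eq: "truncations ?n = Pow {N + 1..<?n} \<union> (\<Union>i<N. ?W i)"
  proof
    show "truncations ?n \<subseteq> Pow {N + 1..<?n} \<union> (\<Union>i<N. ?W i)"
    proof
      fix X assume X: "X \<in> truncations ?n"
      then have sub: "X \<subseteq> {1..<?n}" by (simp add: truncations_def)
      show "X \<in> Pow {N + 1..<?n} \<union> (\<Union>i<N. ?W i)"
      proof (cases "X \<subseteq> {N + 1..}")
        case True
        then have "X \<subseteq> {N + 1..<?n}" using sub by (auto simp: subset_iff)
        then show ?thesis by blast
      next
        case False
        then obtain x where x: "x \<in> X" "x \<le> N" by (auto simp: not_less_eq_eq subset_iff)
        define l where "l = (LEAST x. x \<in> X)"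
        have least: "l \<le> y" if "y \<in> X" for y unfolding l_def using that by (rule Least_le)
        moreover have "l \<in> X" unfolding l_def using x(1) by (rule LeastI)
        ultimately have l: "l \<in> X" "l \<le> N" "X \<subseteq> {l..}" using x by (auto intro: le_trans)
        then have "X \<in> ?W (N - l)" using X by (simp add: truncations_min_def)
        moreover have "N - l < N" using l sub by (auto simp: subset_iff)
        ultimately show ?thesis by blast
      qed
    qed
    show "Pow {N + 1..<?n} \<union> (\<Union>i<N. ?W i) \<subseteq> truncations ?n"
      using truncations_upper[OF p] by (auto simp: truncations_min_def)
  qed
  have "card (\<Union>i<N. ?W i) = (\<Sum>i<N. card (?W i))"
  proof (rule card_UN_disjoint, simp, simp, intro ballI impI)
    fix i j assume ij: "i \<in> {..<N}" "j \<in> {..<N}" "i \<noteq> j"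
    have "N - i = N - j" if "X \<in> ?W i" "X \<in> ?W j" for X
      using that unfolding truncations_min_def by (auto intro!: antisym)
    moreover have "N - i \<noteq> N - j" using ij by auto
    ultimately show "?W i \<inter> ?W j = {}" by blast
  qed
  moreover have "Pow {N + 1..<?n} \<inter> (\<Union>i<N. ?W i) = {}"
    by (fastforce simp: truncations_min_def)
  ultimately have "card (truncations ?n) = card (Pow {N + 1..<?n}) + (\<Sum>i<N. card (?W i))"
    unfolding eq by (subst card_Un_disjoint) auto
  moreover have "2 * N + p - (N + 1) = N + p - 1" by simp
  ultimately show ?thesis by (simp add: card_Pow)
qed

text \<open>
  \<open>D\<close> and \<open>E\<close> are the translates to \<open>0\<close> of the parts of a truncation in \<open>[m, m + R]\<close> and
  in \<open>[2 * m, 2 * m + R)\<close>.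
\<close>

definition patterns :: "nat \<Rightarrow> (nat set \<times> nat set) set" where
  "patterns R = {(D, E). D \<subseteq> {..R} \<and> E \<subseteq> {..<R} \<and> 0 \<in> D \<and> (\<forall>a\<in>D. \<forall>b\<in>D. a + b \<le> R \<longrightarrow> a + b \<in> E)}"

text \<open>Since \<open>R < m\<close>, the two parts described by a pattern are disjoint. Only
  elements of \<open>[m, m + R]\<close> can have a sum up to \<open>n\<close>, so the
  \<open>m - R - 1\<close> numbers strictly between the parts are free.\<close>

lemma card_truncations_min:
  assumes "R < m"
  shows "card (truncations_min (2 * m + R) m) = card (patterns R) * 2 ^ (m - R - 1)"
proof -
  define glue :: "(nat set \<times> nat set) \<times> nat set \<Rightarrow> nat set"
    where "glue z = (+) m ` fst (fst z) \<union> snd z \<union> (+) (2 * m) ` snd (fst z)" for z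
  define split :: "nat set \<Rightarrow> (nat set \<times> nat set) \<times> nat set"
    where "split X = (({i. i \<le> R \<and> m + i \<in> X}, {i. i < R \<and> 2 * m + i \<in> X}), X \<inter> {m + R + 1..<2 * m})" for X
  have "bij_betw glue (patterns R \<times> Pow {m + R + 1..<2 * m}) (truncations_min (2 * m + R) m)"
  proof (rule bij_betw_byWitness[where f' = split])
    show "\<forall>z\<in>patterns R \<times> Pow {m + R + 1..<2 * m}. split (glue z) = z"
    proof
      fix z assume "z \<in> patterns R \<times> Pow {m + R + 1..<2 * m}"
      then obtain D E C where z: "z = ((D, E), C)" "D \<subseteq> {..R}" "E \<subseteq> {..<R}" "C \<subseteq> {m + R + 1..<2 * m}"
        by (auto simp: patterns_def)
      have "x \<in> glue z \<longleftrightarrow> (\<exists>i\<le>R. x = m + i \<and> i \<in> D) \<or> x \<in> C \<or> (\<exists>i<R. x = 2 * m + i \<and> i \<in> E)" for x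
        using z by (auto simp: glue_def)
      then show "split (glue z) = z" unfolding split_def z(1) using z(2-) assms by fastforce
    qed
    show "\<forall>X\<in>truncations_min (2 * m + R) m. glue (split X) = X"
    proof
      fix X assume X: "X \<in> truncations_min (2 * m + R) m"
      then have sub: "X \<subseteq> {m..<2 * m + R}" by (auto simp: truncations_min_def truncations_def subset_iff)
      show "glue (split X) = X"
      proof
        show "glue (split X) \<subseteq> X" by (auto simp: glue_def split_def)
        show "X \<subseteq> glue (split X)"
        proof
          fix x assume x: "x \<in> X"
          then have "m \<le> x" "x < 2 * m + R" using sub by auto
          then consider i where "x = m + i" "i \<le> R" | "x \<in> {m + R + 1..<2 * m}" | i where "x = 2 * m + i" "i < R"
            using that le_Suc_ex[of m x] le_Suc_ex[of "2 * m" x] by (cases "x \<le> m + R"; cases "x < 2 * m") force+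
          then show "x \<in> glue (split X)" using x by cases (auto simp: glue_def split_def)
        qed
      qed
    qed
    show "glue ` (patterns R \<times> Pow {m + R + 1..<2 * m}) \<subseteq> truncations_min (2 * m + R) m"
    proof
      fix X assume "X \<in> glue ` (patterns R \<times> Pow {m + R + 1..<2 * m})"
      then obtain D E C where X: "X = (+) m ` D \<union> C \<union> (+) (2 * m) ` E"
        and DE: "D \<subseteq> {..R}" "E \<subseteq> {..<R}" "C \<subseteq> {m + R + 1..<2 * m}" "0 \<in> D"
          "\<And>a b. a \<in> D \<Longrightarrow> b \<in> D \<Longrightarrow> a + b \<le> R \<Longrightarrow> a + b \<in> E"
        by (auto simp: patterns_def glue_def)
      have sub: "X \<subseteq> {m..<2 * m + R}"
      proof -
        have "(+) m ` D \<subseteq> {m..<2 * m + R}" using DE(1) assms by auto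
        then show ?thesis using DE(2,3) assms unfolding X by auto
      qed
      have low: "x - m \<in> D" if "x \<in> X" "x \<le> m + R" for x
        using that DE(2,3) assms unfolding X by auto
      have "x + y \<in> X" if xy: "x \<in> X" "y \<in> X" "x + y \<le> 2 * m + R" for x y
      proof -
        have ge: "m \<le> x" "m \<le> y" using xy sub by auto
        then have "x \<le> m + R" "y \<le> m + R" using xy(3) by linarith+
        then have "(x - m) + (y - m) \<in> E" using low xy ge by (intro DE(5)) auto
        then have "2 * m + ((x - m) + (y - m)) \<in> X" unfolding X by blast
        moreover have "2 * m + ((x - m) + (y - m)) = x + y" using ge by simp
        ultimately show ?thesis by simp
      qed
      moreover have "m \<in> X" using DE(4) unfolding X by force
      ultimately show "X \<in> truncations_min (2 * m + R) m"
        using sub assms by (fastforce simp: truncations_min_def truncations_def)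
    qed
    show "split ` truncations_min (2 * m + R) m \<subseteq> patterns R \<times> Pow {m + R + 1..<2 * m}"
    proof
      fix z assume "z \<in> split ` truncations_min (2 * m + R) m"
      then obtain X where X: "X \<in> truncations_min (2 * m + R) m" and z: "z = split X" by blast
      have tr: "X \<in> truncations (2 * m + R)" and "m \<in> X" using X by (auto simp: truncations_min_def)
      have "a + b < R \<and> 2 * m + (a + b) \<in> X" if "m + a \<in> X" "m + b \<in> X" "a + b \<le> R" for a b
      proof -
        have "(m + a) + (m + b) \<in> X" using truncations_add[OF tr that(1,2)] that(3) by simp
        then have "2 * m + (a + b) \<in> X" by (simp add: mult_2 add_ac)
        then show ?thesis using truncations_less[OF tr] by fastforce
      qed
      then show "z \<in> patterns R \<times> Pow {m + R + 1..<2 * m}"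
        using \<open>m \<in> X\<close> unfolding z split_def patterns_def by auto
    qed
  qed
  then have "card (truncations_min (2 * m + R) m) = card (patterns R \<times> Pow {m + R + 1..<2 * m})"
    using bij_betw_same_card by metis
  also have "\<dots> = card (patterns R) * 2 ^ (m - R - 1)" by (simp add: card_cartesian_product card_Pow)
  finally show ?thesis .
qed

section \<open>Convergence along each parity\<close>

lemma truncations_min_half: "truncations_min (2 * m) m = {}"
  using truncations_not_sum[of _ "2 * m" m m] by (auto simp: truncations_min_def)

text \<open>Replacing the integer exponent by the smaller real one \<open>i / 8 - 2\<close> makes
  the terms accessible to \<open>real_asymp\<close>, which compares them with
  \<open>1 / i ^ 2\<close>.\<close>

lemma summable_window_bound:
  "summable (\<lambda>i. (real (2 * i + p) + 1) * (sqrt 2 ^ (p + 1) * (99/100) ^ ((2 * i + p) div 16 - 1)))"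
proof (rule summable_comparison_test')
  show "summable (\<lambda>i. (2 * real i + (real p + 1)) * (sqrt 2 ^ (p + 1) * (99/100) powr (real i / 8 - 2)))"
  proof (rule summable_comparison_test_bigo)
    show "summable (\<lambda>i. norm (1 / real i ^ 2))"
      using inverse_power_summable[of 2, where 'a = real] by (simp add: inverse_eq_divide)
    have "(\<lambda>i. (2 * real i + a) * (b * (99/100) powr (real i / 8 - 2))) \<in> O(\<lambda>i. 1 / real i ^ 2)" for a b :: real
    proof -
      have "(\<lambda>i. (2 * real i + a) * ((99/100) powr (real i / 8 - 2))) \<in> O(\<lambda>i. 1 / real i ^ 2)"
        by real_asymp
      from landau_o.big.mult[OF bigo_const this, of b] show ?thesis by (simp add: mult_ac)
    qed
    then show "(\<lambda>i. (2 * real i + (real p + 1)) * (sqrt 2 ^ (p + 1) * (99/100) powr (real i / 8 - 2)))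
      \<in> O(\<lambda>i. 1 / real i ^ 2)" .
  qed
  show "norm ((real (2 * i + p) + 1) * (sqrt 2 ^ (p + 1) * (99/100) ^ ((2 * i + p) div 16 - 1)))
    \<le> (2 * real i + (real p + 1)) * (sqrt 2 ^ (p + 1) * (99/100) powr (real i / 8 - 2))" if "0 \<le> i" for i
  proof -
    \<comment> \<open>The 16 absorbs both the rounding in \<open>div\<close> and the truncated
      subtraction.\<close>
    have "i \<le> 8 * ((2 * i + p) div 16 - 1) + 16" by linarith
    then have "real i \<le> 8 * real ((2 * i + p) div 16 - 1) + 16" by linarith
    then have "real i / 8 - 2 \<le> real ((2 * i + p) div 16 - 1)" by linarith
    then have "(99/100) powr real ((2 * i + p) div 16 - 1) \<le> (99/100 :: real) powr (real i / 8 - 2)"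
      by (intro powr_mono') auto
    then have "(99/100) ^ ((2 * i + p) div 16 - 1) \<le> (99/100 :: real) powr (real i / 8 - 2)"
      by (subst (asm) powr_realpow) auto
    then have "(real (2 * i + p) + 1) * (sqrt 2 ^ (p + 1) * (99/100) ^ ((2 * i + p) div 16 - 1))
      \<le> (2 * real i + (real p + 1)) * (sqrt 2 ^ (p + 1) * (99/100) powr (real i / 8 - 2))"
      by (intro mult_mono) auto
    then show ?thesis by simp
  qed
qed

lemma truncations_limit:
  assumes p: "p < 2"
  shows "\<exists>c>0. (\<lambda>N. real (card (truncations (2 * N + p))) / 2 ^ N) \<longlonglongrightarrow> c"
proof -
  \<comment> \<open>Padding by zero turns the finite sum over the minimum into a series. Below,
    \<open>b i\<close> is the limit of its terms and \<open>M i\<close> dominates them.\<close>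
  define a where "a i N = (if i < N then real (card (truncations_min (2 * N + p) (N - i))) / 2 ^ N else 0)" for i N
  define b where "b i = real (card (patterns (2 * i + p))) / 2 ^ (i + (2 * i + p) + 1)" for i
  define M where "M i = (real (2 * i + p) + 1) * (sqrt 2 ^ (p + 1) * (99/100) ^ ((2 * i + p) div 16 - 1))" for i
  have to_b: "(\<lambda>N. a i N) \<longlonglongrightarrow> b i" for i
  proof (rule tendsto_eventually, rule eventually_sequentiallyI)
    \<comment> \<open>This is exactly \<open>R < m\<close> for \<open>m = N - i\<close> and
      \<open>R = 2 * i + p\<close>; from here on the term is constant in \<open>N\<close>.\<close>
    fix N assume N: "3 * i + p + 1 \<le> N"
    have "2 * (N - i) + (2 * i + p) = 2 * N + p" "N - i - (2 * i + p) - 1 = N - (i + (2 * i + p) + 1)"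
      and "2 * i + p < N - i"
      using N by linarith+
    then have "card (truncations_min (2 * N + p) (N - i)) =
        card (patterns (2 * i + p)) * 2 ^ (N - (i + (2 * i + p) + 1))"
      using card_truncations_min[of "2 * i + p" "N - i"] by metis
    moreover have "(2::real) ^ N = 2 ^ (N - (i + (2 * i + p) + 1)) * 2 ^ (i + (2 * i + p) + 1)"
      using N by (subst power_add[symmetric]) simp
    ultimately show "a i N = b i" using N unfolding a_def b_def by (simp only: of_nat_mult) simp
  qed
  have le: "norm (a i N) \<le> M i" for i N
  proof (cases "i < N")
    case True
    have eq: "2 * N + p = 2 * (N - i) + (2 * i + p)" using True by linarith
    show ?thesis
    \<comment> \<open>\<open>R = 0\<close> lies outside the locale \<open>window\<close>; there
      \<open>m + m = n\<close> leaves no sets at all.\<close>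
    proof (cases "2 * i + p = 0")
      case True
      then show ?thesis using truncations_min_half[of N] by (simp add: a_def M_def)
    next
      case False
      have "real (card (truncations_min (2 * N + p) (N - i))) \<le>
        (real (2 * i + p) + 1) * (sqrt 2 ^ (2 * N + p + 1) * (99/100) ^ ((2 * i + p) div 16 - 1))"
        using card_truncations_min_le[of "N - i" "2 * i + p"] False True unfolding eq by simp
      also have "sqrt 2 ^ (2 * N + p + 1) = 2 ^ N * sqrt 2 ^ (p + 1)"
        by (simp add: power_add power_mult)
      finally have "real (card (truncations_min (2 * N + p) (N - i))) \<le> M i * 2 ^ N"
        by (simp add: M_def mult_ac)
      then show ?thesis using True by (simp add: a_def pos_divide_le_eq)
    qed
  qed (simp add: a_def M_def)
  have "\<forall>\<^sub>F (i, N) in at_top \<times>\<^sub>F sequentially. norm (a i N) \<le> M i"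
    using le by (intro always_eventually) auto
  moreover have "summable M" unfolding M_def by (rule summable_window_bound)
  ultimately have lim: "summable (\<lambda>i. norm (b i)) \<and> (\<lambda>N. \<Sum>i. a i N) \<longlonglongrightarrow> (\<Sum>i. b i)"
    using tannerys_theorem[of a b sequentially M] to_b by simp
  have "(\<lambda>N. 2 ^ p / 2 + (\<Sum>i. a i N)) \<longlonglongrightarrow> 2 ^ p / 2 + (\<Sum>i. b i)"
    using lim by (intro tendsto_add tendsto_const) simp
  moreover have "\<forall>\<^sub>F N in sequentially. 2 ^ p / 2 + (\<Sum>i. a i N) = real (card (truncations (2 * N + p))) / 2 ^ N"
  proof (rule eventually_sequentiallyI)
    fix N :: nat assume N: "1 \<le> N"
    have "(\<Sum>i. a i N) = (\<Sum>i<N. a i N)" by (rule suminf_finite) (auto simp: a_def)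
    also have "\<dots> = (\<Sum>i<N. real (card (truncations_min (2 * N + p) (N - i)))) / 2 ^ N"
      by (simp add: a_def sum_divide_distrib)
    moreover have "2 ^ (N + p - 1) / 2 ^ N = (2 ^ p / 2 :: real)"
      using N by (simp add: power_diff power_add)
    ultimately show "2 ^ p / 2 + (\<Sum>i. a i N) = real (card (truncations (2 * N + p))) / 2 ^ N"
      unfolding card_truncations_split[OF p] by (simp add: add_divide_distrib)
  qed
  ultimately have "(\<lambda>N. real (card (truncations (2 * N + p))) / 2 ^ N) \<longlonglongrightarrow> 2 ^ p / 2 + (\<Sum>i. b i)"
    by (rule Lim_transform_eventually)
  moreover have "0 \<le> (\<Sum>i. b i)"
  proof (rule suminf_nonneg)
    show "summable b" using lim summable_norm_cancel by blast
  qed (simp add: b_def)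
  moreover have "(0::real) < 2 ^ p / 2" by simp
  ultimately show ?thesis by (meson add_pos_nonneg)
qed

section \<open>From truncations back to semigroups\<close>

lemma submonoid_mult: "submonoid M \<Longrightarrow> x \<in> M \<Longrightarrow> k * x \<in> M"
  by (induction k) (auto simp: submonoid_def)

text \<open>The least positive difference \<open>d\<close> of two elements divides every element,
  hence is 1. So \<open>M\<close> contains some \<open>y\<close> and \<open>y + 1\<close>, and these
  generate everything from \<open>y * y\<close> on.\<close>

lemma finite_Compl_submonoid:
  assumes M: "submonoid M" and gcd1: "\<And>d. (\<forall>x\<in>M. d dvd x) \<Longrightarrow> d = 1"
  shows "finite (- M)"
proof -
  have add: "x + y \<in> M" if "x \<in> M" "y \<in> M" for x y using M that by (simp add: submonoid_def)
  \<comment> \<open>The instance \<open>d = 0\<close> of the hypothesis excludes the trivial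
    monoid.\<close>
  have "\<not> M \<subseteq> {0}" using gcd1[of 0] by auto
  then obtain x where x: "x \<in> M" "x \<noteq> 0" by blast
  define isdiff where "isdiff d \<longleftrightarrow> 0 < d \<and> (\<exists>y\<in>M. y + d \<in> M)" for d
  define d where "d = (LEAST d. isdiff d)"
  have "isdiff x" using x M by (auto simp: isdiff_def submonoid_def)
  then have "isdiff d" unfolding d_def by (rule LeastI)
  then obtain y where y: "0 < d" "y \<in> M" "y + d \<in> M" by (auto simp: isdiff_def)
  have "d dvd a" if a: "a \<in> M" for a
  proof (rule ccontr)
    assume "\<not> d dvd a"
    then have "0 < a mod d" by (simp add: mod_greater_zero_iff_not_dvd)
    moreover have "(a div d) * (y + d) \<in> M" using submonoid_mult[OF M y(3)] .
    \<comment> \<open>A nonzero remainder would thus be a smaller difference of two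
      elements.\<close>
    moreover have "(a div d) * (y + d) + a mod d = (a div d) * y + a"
      by (simp add: distrib_left)
    then have "(a div d) * (y + d) + a mod d \<in> M"
      using add[OF submonoid_mult[OF M y(2)] a] by simp
    ultimately have "isdiff (a mod d)" unfolding isdiff_def by blast
    then have "d \<le> a mod d" unfolding d_def by (rule Least_le)
    then show False using mod_less_divisor[OF y(1), of a] by linarith
  qed
  then have "d = 1" using gcd1 by blast
  have "z \<in> M" if z: "y * y \<le> z" for z
  proof (cases "y = 0")
    case True
    then show ?thesis using submonoid_mult[OF M, of 1 z] y \<open>d = 1\<close> by simp
  next
    case False
    then have "z mod y < y" "y \<le> z div y"
      using z by (simp_all add: less_eq_div_iff_mult_less_eq)
    then have "z mod y \<le> z div y" by simp
    \<comment> \<open>Each unit of the remainder turns one summand \<open>y\<close> into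
      \<open>y + 1\<close>.\<close>
    then have "(z div y - z mod y) * y + (z mod y) * (y + 1) = (z div y) * y + z mod y"
      by (simp add: diff_mult_distrib distrib_left mult_le_mono1)
    then show ?thesis
      using add[OF submonoid_mult[OF M y(2), of "z div y - z mod y"] submonoid_mult[OF M y(3), of "z mod y"]]
        \<open>d = 1\<close> by simp
  qed
  then have "- M \<subseteq> {..<y * y}" by (meson ComplD lessThan_iff not_le subsetI)
  then show ?thesis by (rule finite_subset) simp
qed

text \<open>The inverse map adjoins 0 and everything above \<open>n\<close>.\<close>

lemma num_by_frobenius_eq:
  assumes "0 < n"
  shows "num_by_frobenius n = card (truncations n)"
proof -
  have "bij_betw (\<lambda>S. S \<inter> {1..<n}) {S. numerical_semigroup S \<and> frobenius S = int n} (truncations n)"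
  proof (rule bij_betw_byWitness[where f' = "\<lambda>X. insert 0 X \<union> {n<..}"])
    have frob: "n \<notin> S \<and> {n<..} \<subseteq> S" if "numerical_semigroup S" "frobenius S = int n" for S
    proof -
      have "S \<noteq> UNIV" and n: "n = Max (- S)"
        using that(2) by (auto simp: frobenius_def split: if_splits)
      then have fin: "finite (- S)" "- S \<noteq> {}" using that(1) by (auto simp: numerical_semigroup_def)
      then have "n \<in> - S" unfolding n by (rule Max_in)
      moreover have "x \<le> n" if "x \<in> - S" for x unfolding n using fin(1) that by (rule Max_ge)
      ultimately show ?thesis by force
    qed
    show "\<forall>S\<in>{S. numerical_semigroup S \<and> frobenius S = int n}. insert 0 (S \<inter> {1..<n}) \<union> {n<..} = S"
    proof
      fix S assume "S \<in> {S. numerical_semigroup S \<and> frobenius S = int n}"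
      then have S: "n \<notin> S" "{n<..} \<subseteq> S" "0 \<in> S"
        using frob by (auto simp: numerical_semigroup_def submonoid_def)
      have "x = 0 \<or> x \<in> {1..<n} \<or> x \<in> {n<..}" if "x \<in> S" for x
        using that S(1) by (cases "x = n") auto
      then show "insert 0 (S \<inter> {1..<n}) \<union> {n<..} = S" using S by blast
    qed
    show "\<forall>X\<in>truncations n. (insert 0 X \<union> {n<..}) \<inter> {1..<n} = X"
      by (auto simp: truncations_def)
    show "(\<lambda>S. S \<inter> {1..<n}) ` {S. numerical_semigroup S \<and> frobenius S = int n} \<subseteq> truncations n"
    proof
      fix X assume "X \<in> (\<lambda>S. S \<inter> {1..<n}) ` {S. numerical_semigroup S \<and> frobenius S = int n}"
      then obtain S where X: "X = S \<inter> {1..<n}" and S: "submonoid S" "n \<notin> S"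
        using frob by (auto simp: numerical_semigroup_def)
      have "x + y \<in> X" if "x \<in> X" "y \<in> X" "x + y \<le> n" for x y
      proof -
        have "x + y \<in> S" using S(1) that by (auto simp: X submonoid_def)
        moreover from this have "x + y \<noteq> n" using S(2) by auto
        ultimately show ?thesis using that by (auto simp: X)
      qed
      then show "X \<in> truncations n" by (auto simp: truncations_def X)
    qed
    show "(\<lambda>X. insert 0 X \<union> {n<..}) ` truncations n \<subseteq> {S. numerical_semigroup S \<and> frobenius S = int n}"
    proof
      fix S assume "S \<in> (\<lambda>X. insert 0 X \<union> {n<..}) ` truncations n"
      then obtain X where X: "X \<in> truncations n" and S: "S = insert 0 X \<union> {n<..}" by blast
      have "x + y \<in> S" if "x \<in> S" "y \<in> S" for x y
        using that truncations_add[OF X, of x y] unfolding S by (cases "x + y \<le> n") auto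
      then have sub: "submonoid S" unfolding submonoid_def by (simp add: S)
      have "- S \<subseteq> {..n}" by (auto simp: S)
      then have fin: "finite (- S)" by (rule finite_subset) simp
      have "n \<notin> S" using assms truncations_less[OF X] by (auto simp: S)
      then have "Max (- S) = n" using fin \<open>- S \<subseteq> {..n}\<close> by (intro Max_eqI) auto
      then have "frobenius S = int n" using \<open>n \<notin> S\<close> by (auto simp: frobenius_def)
      then show "S \<in> {S. numerical_semigroup S \<and> frobenius S = int n}"
        using sub fin by (simp add: numerical_semigroup_def)
    qed
  qed
  then show ?thesis unfolding num_by_frobenius_def by (rule bij_betw_same_card)
qed

text \<open>All primitives other than \<open>n\<close> lie below \<open>n\<close>, so
  \<open>S\<close> is generated by \<open>n\<close> and its truncation; this gives injectivity. The
  sum \<open>n\<close> is avoided because \<open>n\<close> is indecomposable.\<close>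

lemma num_by_max_primitive_le: "num_by_max_primitive n \<le> card (truncations n)"
  unfolding num_by_max_primitive_def
proof (rule card_inj_on_le[of "\<lambda>S. S \<inter> {1..<n}"])
  let ?A = "{S. numerical_semigroup S \<and> Max (primitives S) = n}"
  have n: "n \<in> indecomposables S" "primitives S \<subseteq> {..n}" "submonoid S"
    and hull: "submonoid hull (primitives S) = S" if "S \<in> ?A" for S
  proof -
    have S: "numerical_semigroup S" "Max (primitives S) = n" using that by auto
    show "n \<in> indecomposables S"
      using Max_in[OF finite_primitives primitives_nonempty, OF S(1) S(1)] S
      by (simp add: primitives_eq_indecomposables)
    show "primitives S \<subseteq> {..n}" using finite_primitives[OF S(1)] S(2) by auto
    show "submonoid S" using S(1) by (simp add: numerical_semigroup_def)
    show "submonoid hull (primitives S) = S"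
      using minimal_generating_set_primitives[OF S(1)]
      by (simp add: minimal_generating_set_def generates_def)
  qed
  have prim: "primitives S \<subseteq> insert n (S \<inter> {1..<n})" if "S \<in> ?A" for S
  proof
    fix x assume x: "x \<in> primitives S"
    then have "x \<in> indecomposables S" using that primitives_eq_indecomposables by auto
    then have "x \<in> S" "x \<noteq> 0" by (auto simp: indecomposables_def)
    then show "x \<in> insert n (S \<inter> {1..<n})" using n(2)[OF that] x by fastforce
  qed
  show "inj_on (\<lambda>S. S \<inter> {1..<n}) ?A"
  proof (rule inj_onI)
    have "S \<subseteq> T" if S: "S \<in> ?A" and T: "T \<in> ?A" and eq: "S \<inter> {1..<n} = T \<inter> {1..<n}" for S T
    proof -
      have "n \<in> T" using n(1)[OF T] by (simp add: indecomposables_def)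
      then have "primitives S \<subseteq> T" using prim[OF S] eq by blast
      then have "submonoid hull (primitives S) \<subseteq> T" using n(3)[OF T] by (rule hull_minimal)
      then show ?thesis using hull[OF S] by simp
    qed
    then show "S = T" if "S \<in> ?A" "T \<in> ?A" "S \<inter> {1..<n} = T \<inter> {1..<n}" for S T
      using that by (intro subset_antisym) simp_all
  qed
  show "(\<lambda>S. S \<inter> {1..<n}) ` ?A \<subseteq> truncations n"
  proof
    fix X assume "X \<in> (\<lambda>S. S \<inter> {1..<n}) ` ?A"
    then obtain S where S: "S \<in> ?A" and X: "X = S \<inter> {1..<n}" by blast
    have "x + y \<in> X" if "x \<in> X" "y \<in> X" "x + y \<le> n" for x y
    proof -
      have "x + y \<in> S" using n(3)[OF S] that by (auto simp: X submonoid_def)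
      moreover have "n \<noteq> x + y" using n(1)[OF S] that by (auto simp: X indecomposables_def)
      ultimately show ?thesis using that by (auto simp: X)
    qed
    then show "X \<in> truncations n" by (auto simp: truncations_def X)
  qed
qed simp

text \<open>Generating by \<open>X\<close> and \<open>n\<close> adds nothing below \<open>n\<close>
  except 0. Hence \<open>X\<close> can be recovered and \<open>n\<close> stays indecomposable; the
  divisor condition makes the complement finite.\<close>

lemma num_by_max_primitive_ge:
  assumes "0 < n"
  shows "card {X \<in> truncations n. \<forall>d. (\<forall>x\<in>insert n X. d dvd x) \<longrightarrow> d = 1} \<le> num_by_max_primitive n"
  unfolding num_by_max_primitive_def
proof (rule card_inj_on_le[of "\<lambda>X. submonoid hull (insert n X)"])
  let ?A = "{X \<in> truncations n. \<forall>d. (\<forall>x\<in>insert n X. d dvd x) \<longrightarrow> d = 1}"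
  let ?H = "\<lambda>X. submonoid hull (insert n X)"
  have low: "?H X \<subseteq> insert 0 X \<union> {n..}" if X: "X \<in> truncations n" for X
  proof (rule hull_minimal)
    show "insert n X \<subseteq> insert 0 X \<union> {n..}" by auto
    have "x + y \<in> insert 0 X \<union> {n..}" if "x \<in> insert 0 X \<union> {n..}" "y \<in> insert 0 X \<union> {n..}" for x y
      using that truncations_add[OF X, of x y] by (cases "x + y \<le> n") auto
    then show "submonoid (insert 0 X \<union> {n..})" unfolding submonoid_def by simp
  qed
  have X_eq: "?H X \<inter> {1..<n} = X" if X: "X \<in> truncations n" for X
  proof
    show "?H X \<inter> {1..<n} \<subseteq> X" using low[OF X] by auto
    have "X \<subseteq> {1..<n}" using X by (simp add: truncations_def)
    then show "X \<subseteq> ?H X \<inter> {1..<n}" using hull_subset[of "insert n X" submonoid] by blast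
  qed
  show "inj_on ?H ?A"
    by (rule inj_on_inverseI[of _ "\<lambda>S. S \<inter> {1..<n}"]) (use X_eq in auto)
  show "?H ` ?A \<subseteq> {S. numerical_semigroup S \<and> Max (primitives S) = n}"
  proof
    fix S assume "S \<in> ?H ` ?A"
    then obtain X where X: "X \<in> truncations n" and S: "S = ?H X"
      and gcd1: "\<And>d. (\<forall>x\<in>insert n X. d dvd x) \<Longrightarrow> d = 1" by auto
    have sub: "submonoid S" unfolding S by (rule submonoid_hull)
    have gens: "insert n X \<subseteq> S" unfolding S by (rule hull_subset)
    have "finite (- S)"
      using sub gens gcd1 by (intro finite_Compl_submonoid) blast+
    then have ns: "numerical_semigroup S" using sub by (simp add: numerical_semigroup_def)
    have prim: "primitives S = indecomposables S" by (rule primitives_eq_indecomposables[OF ns])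
    have "indecomposables S \<subseteq> insert n X"
      by (rule indecomposables_subset) (simp add: generates_def S)
    then have le: "x \<le> n" if "x \<in> primitives S" for x
      using that prim truncations_less[OF X] by (auto intro: less_imp_le)
    have "n \<noteq> a + b" if "a \<in> S" "b \<in> S" "a \<noteq> 0" "b \<noteq> 0" for a b
    proof
      assume "n = a + b"
      then have "a \<in> X" "b \<in> X" using that low[OF X] unfolding S by force+
      then show False using truncations_not_sum[OF X] \<open>n = a + b\<close> by blast
    qed
    then have "n \<in> primitives S" using gens assms by (auto simp: prim indecomposables_def)
    then have "Max (primitives S) = n" using le finite_primitives[OF ns] by (intro Max_eqI)
    then show "S \<in> {S. numerical_semigroup S \<and> Max (primitives S) = n}" using ns by simp
  qed
qed (rule finite_by_max_primitive)

lemma card_truncations_dvd: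
  assumes "0 < d" "d dvd n"
  shows "card {X \<in> truncations n. \<forall>x\<in>X. d dvd x} \<le> card (truncations (n div d))"
proof (rule surj_card_le)
  show "{X \<in> truncations n. \<forall>x\<in>X. d dvd x} \<subseteq> (\<lambda>Y. (*) d ` Y) ` truncations (n div d)"
  proof
    fix X assume "X \<in> {X \<in> truncations n. \<forall>x\<in>X. d dvd x}"
    then have X: "X \<in> truncations n" and dvd: "\<forall>x\<in>X. d dvd x" by auto
    obtain k where n: "n = d * k" using assms(2) by (rule dvdE)
    have k: "n div d = k" using assms(1) by (simp add: n)
    define Y where "Y = {y. d * y \<in> X}"
    have "X = (*) d ` Y" using dvd by (auto simp: Y_def dvd_def)
    moreover have "Y \<in> truncations k"
    proof -
      have "y \<in> {1..<k}" if "y \<in> Y" for y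
      proof -
        have "1 \<le> d * y" "d * y < d * k" using that X by (auto simp: Y_def n truncations_def)
        then have "y \<noteq> 0" "y < k" by (auto intro: ccontr)
        then show ?thesis by simp
      qed
      moreover have "x + y \<in> Y" if "x \<in> Y" "y \<in> Y" "x + y \<le> k" for x y
        using truncations_add[OF X, of "d * x" "d * y"] that assms(1)
        by (simp add: Y_def n flip: distrib_left)
      ultimately show ?thesis by (auto simp: truncations_def)
    qed
    ultimately show "X \<in> (\<lambda>Y. (*) d ` Y) ` truncations (n div d)" unfolding k by blast
  qed
qed simp

text \<open>If the divisor condition fails for \<open>X\<close>, some \<open>d \<ge> 2\<close>
  divides \<open>n\<close> and all of \<open>X\<close>. The union bound runs over all
  \<open>d\<close> up to \<open>n\<close>; nondivisors contribute the empty set.\<close>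

lemma card_truncations_le:
  assumes "0 < n"
  shows "card (truncations n) \<le> num_by_max_primitive n + (\<Sum>d\<in>{2..n}. card (truncations (n div d)))"
proof -
  let ?C = "{X \<in> truncations n. \<forall>d. (\<forall>x\<in>insert n X. d dvd x) \<longrightarrow> d = 1}"
  let ?D = "\<lambda>d. {X \<in> truncations n. d dvd n \<and> (\<forall>x\<in>X. d dvd x)}"
  have "truncations n \<subseteq> ?C \<union> (\<Union>d\<in>{2..n}. ?D d)"
  proof
    fix X assume X: "X \<in> truncations n"
    show "X \<in> ?C \<union> (\<Union>d\<in>{2..n}. ?D d)"
    proof (cases "X \<in> ?C")
      case False
      then obtain d where d: "d dvd n" "\<forall>x\<in>X. d dvd x" "d \<noteq> 1" using X by auto
      have "d \<noteq> 0" "d \<le> n" using d(1) assms by (auto dest: dvd_imp_le)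
      then have "d \<in> {2..n}" using d(3) by auto
      then show ?thesis using X d by blast
    qed blast
  qed
  then have "card (truncations n) \<le> card (?C \<union> (\<Union>d\<in>{2..n}. ?D d))"
    by (intro card_mono) auto
  also have "\<dots> \<le> card ?C + (\<Sum>d\<in>{2..n}. card (?D d))"
    using card_Un_le[of ?C "\<Union>d\<in>{2..n}. ?D d"] card_UN_le[of "{2..n}" ?D] by simp
  also have "\<dots> \<le> num_by_max_primitive n + (\<Sum>d\<in>{2..n}. card (truncations (n div d)))"
  proof (intro add_mono sum_mono num_by_max_primitive_ge assms)
    fix d assume "d \<in> {2..n}"
    then show "card (?D d) \<le> card (truncations (n div d))"
      using card_truncations_dvd[of d n] by (cases "d dvd n") auto
  qed
  finally show ?thesis .
qed

section \<open>Asymptotics\<close>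

lemma sqrt2_power_parity: "sqrt 2 ^ (2 * N + p) = 2 ^ N * sqrt 2 ^ p"
  by (simp add: power_add power_mult)

lemma card_truncations_upper:
  "\<exists>C>0. \<forall>n. real (card (truncations n)) \<le> C * sqrt 2 ^ n"
proof -
  have "\<exists>K>0. \<forall>N. real (card (truncations (2 * N + p))) \<le> K * sqrt 2 ^ (2 * N + p)" if p: "p < 2" for p
  proof -
    obtain c where "(\<lambda>N. real (card (truncations (2 * N + p))) / 2 ^ N) \<longlonglongrightarrow> c"
      using truncations_limit[OF p] by blast
    then have "Bseq (\<lambda>N. real (card (truncations (2 * N + p))) / 2 ^ N)"
      by (intro convergent_imp_Bseq convergentI)
    then obtain K where K: "0 < K" "\<And>N. norm (real (card (truncations (2 * N + p))) / 2 ^ N) \<le> K"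
      by (auto elim: BseqE)
    have "real (card (truncations (2 * N + p))) \<le> K * sqrt 2 ^ (2 * N + p)" for N
    proof -
      have "real (card (truncations (2 * N + p))) \<le> K * 2 ^ N"
        using K(2)[of N] by (simp add: pos_divide_le_eq)
      also have "\<dots> \<le> K * 2 ^ N * sqrt 2 ^ p"
        using K(1) by (simp add: one_le_power)
      finally show ?thesis unfolding sqrt2_power_parity by (simp add: mult.assoc)
    qed
    then show ?thesis using K(1) by blast
  qed
  from this[of 0] this[of 1] obtain K0 K1 where K: "0 < K0" "0 < K1"
    and le: "\<And>N. real (card (truncations (2 * N + 0))) \<le> K0 * sqrt 2 ^ (2 * N + 0)"
      "\<And>N. real (card (truncations (2 * N + 1))) \<le> K1 * sqrt 2 ^ (2 * N + 1)" by auto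
  have "real (card (truncations n)) \<le> max K0 K1 * sqrt 2 ^ n" for n
  proof -
    have "real (card (truncations n)) \<le> K0 * sqrt 2 ^ n \<or> real (card (truncations n)) \<le> K1 * sqrt 2 ^ n"
      using le[of "n div 2"] by (cases "even n") (auto elim!: evenE oddE)
    moreover have "K0 * sqrt 2 ^ n \<le> max K0 K1 * sqrt 2 ^ n" "K1 * sqrt 2 ^ n \<le> max K0 K1 * sqrt 2 ^ n"
      by (auto intro: mult_right_mono)
    ultimately show ?thesis by linarith
  qed
  then show ?thesis using K by (intro exI[of _ "max K0 K1"]) auto
qed

text \<open>The unconstrained sets above \<open>n div 2\<close> already suffice.\<close>

lemma card_truncations_lower:
  assumes "0 < n"
  shows "sqrt 2 ^ n / 2 \<le> real (card (truncations n))"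
proof -
  define N p where "N = n div 2" and "p = n mod 2"
  have n: "n = 2 * N + p" and p: "p < 2" by (simp_all add: N_def p_def)
  have "N + p \<ge> 1" using n assms by linarith
  have "sqrt 2 ^ p \<le> 2 ^ p"
    by (rule power_mono) (simp_all add: real_le_lsqrt)
  then have "2 ^ N * sqrt 2 ^ p \<le> 2 ^ N * 2 ^ p" by (intro mult_left_mono) auto
  then have "sqrt 2 ^ n / 2 \<le> 2 ^ (N + p) / 2"
    unfolding n sqrt2_power_parity power_add[of "2::real" N p] by (intro divide_right_mono) auto
  also have "\<dots> = 2 ^ (N + p - 1)" using \<open>N + p \<ge> 1\<close> by (simp add: power_diff)
  also have "\<dots> \<le> real (card (truncations n))"
    unfolding n card_truncations_split[OF p] by (simp add: sum_nonneg)
  finally show ?thesis .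
qed

text \<open>The exceptional sets number at most \<open>n * C * sqrt 2 ^ (n div 2)\<close>,
  exponentially fewer than the \<open>sqrt 2 ^ n / 2\<close> truncations guaranteed.\<close>

lemma ratio_limit: "(\<lambda>n. real (num_by_max_primitive n) / real (num_by_frobenius n)) \<longlonglongrightarrow> 1"
proof -
  obtain C where C: "0 < C" "\<And>n. real (card (truncations n)) \<le> C * sqrt 2 ^ n"
    using card_truncations_upper by blast
  have sq1: "1 \<le> sqrt (2::real)" by simp
  have bounds: "1 - 2 * C * (real n * (1 / sqrt 2) powr (real n / 2)) \<le>
        real (num_by_max_primitive n) / real (num_by_frobenius n) \<and>
      real (num_by_max_primitive n) / real (num_by_frobenius n) \<le> 1" if n: "0 < n" for n
  proof -
    let ?A = "real (num_by_max_primitive n)" and ?N = "real (card (truncations n))"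
    have "?N \<le> real (num_by_max_primitive n + (\<Sum>d\<in>{2..n}. card (truncations (n div d))))"
      using card_truncations_le[OF n] by (rule of_nat_mono)
    also have "\<dots> = ?A + (\<Sum>d\<in>{2..n}. real (card (truncations (n div d))))" by simp
    also have "\<dots> \<le> ?A + (\<Sum>d\<in>{2..n}. C * sqrt 2 ^ (n div 2))"
    proof (intro add_left_mono sum_mono)
      fix d assume "d \<in> {2..n}"
      then have "n div d \<le> n div 2" by (intro div_le_mono2) auto
      then have "C * sqrt 2 ^ (n div d) \<le> C * sqrt 2 ^ (n div 2)"
        using C(1) by (intro mult_left_mono power_increasing sq1) auto
      then show "real (card (truncations (n div d))) \<le> C * sqrt 2 ^ (n div 2)"
        using C(2)[of "n div d"] by linarith
    qed
    also have "\<dots> \<le> ?A + real n * (C * sqrt 2 ^ (n div 2))"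
      using C(1) by (simp add: mult_right_mono)
    finally have N: "?N \<le> ?A + real n * (C * sqrt 2 ^ (n div 2))" .
    have lower: "sqrt 2 ^ n / 2 \<le> ?N" by (rule card_truncations_lower[OF n])
    moreover have "0 < sqrt (2::real) ^ n / 2" by simp
    ultimately have pos: "0 < ?N" by linarith
    have "sqrt 2 ^ (n div 2) / sqrt 2 ^ n = (1 / sqrt 2) ^ (n - n div 2)"
      by (simp add: power_diff power_one_over)
    also have "\<dots> = (1 / sqrt 2) powr real (n - n div 2)"
      by (subst powr_realpow) auto
    also have "\<dots> \<le> (1 / sqrt 2) powr (real n / 2)"
    proof (rule powr_mono')
      have "n \<le> 2 * (n - n div 2)" by linarith
      then show "real n / 2 \<le> real (n - n div 2)" by linarith
    qed auto
    finally have pw: "sqrt 2 ^ (n div 2) / sqrt 2 ^ n \<le> (1 / sqrt 2) powr (real n / 2)" .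
    have "?N / ?N = 1" using pos by (intro divide_self) linarith
    then have "1 - ?A / ?N = (?N - ?A) / ?N" by (simp only: diff_divide_distrib)
    also have "\<dots> \<le> (real n * (C * sqrt 2 ^ (n div 2))) / ?N"
      using N pos by (intro divide_right_mono) auto
    also have "\<dots> \<le> (real n * (C * sqrt 2 ^ (n div 2))) / (sqrt 2 ^ n / 2)"
      using lower C(1) by (intro frac_le) auto
    also have "\<dots> = 2 * C * (real n * (sqrt 2 ^ (n div 2) / sqrt 2 ^ n))" by simp
    also have "\<dots> \<le> 2 * C * (real n * (1 / sqrt 2) powr (real n / 2))"
      using pw C(1) by (intro mult_left_mono) auto
    finally have "1 - 2 * C * (real n * (1 / sqrt 2) powr (real n / 2)) \<le> ?A / ?N" by linarith
    moreover have "?A \<le> ?N" using num_by_max_primitive_le by simp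
    then have "?A / ?N \<le> 1" using pos by (simp only: divide_le_eq_1_pos)
    ultimately show ?thesis unfolding num_by_frobenius_eq[OF n] by simp
  qed
  show ?thesis
  proof (rule tendsto_sandwich)
    have "(\<lambda>n. real n * (1 / sqrt 2) powr (real n / 2)) \<longlonglongrightarrow> 0" by real_asymp
    from tendsto_diff[OF tendsto_const tendsto_mult_right_zero[OF this]]
    show "(\<lambda>n. 1 - 2 * C * (real n * (1 / sqrt 2) powr (real n / 2))) \<longlonglongrightarrow> 1" by simp
    show "\<forall>\<^sub>F n in sequentially. 1 - 2 * C * (real n * (1 / sqrt 2) powr (real n / 2)) \<le>
        real (num_by_max_primitive n) / real (num_by_frobenius n)"
      by (rule eventually_sequentiallyI[of 1]) (use bounds in auto)
    show "\<forall>\<^sub>F n in sequentially. real (num_by_max_primitive n) / real (num_by_frobenius n) \<le> 1"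
      by (rule eventually_sequentiallyI[of 1]) (use bounds in auto)
  qed simp
qed

text \<open>Multiply the ratio limit, along one parity, by the limit for \<open>truncations\<close>,
  which \<open>num_by_frobenius\<close> equals for positive argument.\<close>

lemma max_primitive_limit:
  assumes p: "p < 2"
  shows "\<exists>c>0. (\<lambda>N. real (num_by_max_primitive (2 * N + p)) / 2 ^ N) \<longlonglongrightarrow> c"
proof -
  obtain c where c: "0 < c" "(\<lambda>N. real (card (truncations (2 * N + p))) / 2 ^ N) \<longlonglongrightarrow> c"
    using truncations_limit[OF p] by blast
  have "strict_mono (\<lambda>N. 2 * N + p)" by (auto simp: strict_mono_def)
  from LIMSEQ_subseq_LIMSEQ[OF ratio_limit this] c(2)
  have "(\<lambda>N. real (num_by_max_primitive (2 * N + p)) / real (num_by_frobenius (2 * N + p)) *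
      (real (card (truncations (2 * N + p))) / 2 ^ N)) \<longlonglongrightarrow> 1 * c"
    unfolding o_def by (rule tendsto_mult)
  moreover have "\<forall>\<^sub>F N in sequentially.
      real (num_by_max_primitive (2 * N + p)) / real (num_by_frobenius (2 * N + p)) *
      (real (card (truncations (2 * N + p))) / 2 ^ N) = real (num_by_max_primitive (2 * N + p)) / 2 ^ N"
  proof (rule eventually_sequentiallyI)
    fix N :: nat assume "1 \<le> N"
    then have n: "0 < 2 * N + p" by simp
    have "0 < sqrt (2::real) ^ (2 * N + p) / 2" by simp
    then have "real (card (truncations (2 * N + p))) \<noteq> 0"
      using card_truncations_lower[OF n] by linarith
    then show "real (num_by_max_primitive (2 * N + p)) / real (num_by_frobenius (2 * N + p)) *
        (real (card (truncations (2 * N + p))) / 2 ^ N) = real (num_by_max_primitive (2 * N + p)) / 2 ^ N"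
      unfolding num_by_frobenius_eq[OF n] by simp
  qed
  ultimately have "(\<lambda>N. real (num_by_max_primitive (2 * N + p)) / 2 ^ N) \<longlonglongrightarrow> c"
    by (simp add: Lim_transform_eventually)
  then show ?thesis using c(1) by blast
qed

theorem corollary1p4:
  shows "(\<lambda>n. real (num_by_max_primitive n) / real (num_by_frobenius n)) \<longlonglongrightarrow> 1
    \<and> (\<exists>c0 c1 :: real. c0 > 0 \<and> c1 > 0
        \<and> (\<lambda>n. real (num_by_max_primitive (2 * n)) / 2 ^ n) \<longlonglongrightarrow> c0
        \<and> (\<lambda>n. real (num_by_max_primitive (2 * n + 1)) / 2 ^ n) \<longlonglongrightarrow> c1)"
  using ratio_limit max_primitive_limit[of 0] max_primitive_limit[of 1] by auto

end
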